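(* Let $\mathfrak v$ be a finite prime of $A=\mathbb F_q[\theta]$. Let $k_0,n$ be positive integers such that $k_0-2n$ is a positive multiple of $q-1$ and $n\le p^{\operatorname{ord}_p(k_0-n)}$. Put $$f_0:=\sum_{a\in A_{\mathfrak v,+}} a^{k_0-n}G_n(u_a),\qquad f_1:=\sum_{a\in A_+\cap\mathfrak v} a^{k_0-n}G_n(u_a),$$ viewed as power series in $u$. Let $g\in A$ be a monic irreducible with $g\notin\mathfrak v$. Then $T_gf_0=g^nf_0$ and $T_gf_1=g^nf_1$, where $T_g$ is the weight-$k_0$ Hecke operator on power series.
   Context: $q=p^{m_0}$, $A=\mathbb F_q[\theta]$, $K=\mathbb F_q(\theta)$, $\mathbb C_\infty$ the completion of an algebraic closure of $\mathbb F_q((1/\theta))$; $A_+$ = monic elements of $A$, and $A_{\mathfrak v,+}$ = monic elements of $A$ prime to $\mathfrak v$. $C$ is the Carlitz module with period $\tilde\pi$, lattice $\Lambda_C=A\tilde\pi$ and exponential $e_C$. For an $\mathbb F_q$-lattice $\Lambda\subset\mathbb C_\infty$, $e_\Lambda(z)=z\prod_{0\neq\lambda\in\Lambda}(1-z/\lambda)$, and for $j\ge1$ the Goss polynomial $G_{j,\Lambda}(X)$ is the monic degree-$j$ polynomial with $G_{j,\Lambda}(1/e_\Lambda(z))=\sum_{\lambda\in\Lambda}(z+\lambda)^{-j}$; $G_n:=G_{n,\Lambda_C}$. Set $u(z)=1/e_C(\tilde\pi z)$ and $u_a=u(az)$ for $a\in A_+$, a power series in $u$ with coefficients in $K$. For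 $g$ monic irreducible of degree $d$, $\Lambda_g\subset\mathbb C_\infty$ denotes the $\mathbb F_q$-module of $g$-division points of the Carlitz module. The Hecke operator $T_g$ in weight $k_0$ acts on a power series $F=\sum_{j\ge0}c_ju^j$ (here with $c_0=0$) by $T_gF:=g^{k_0}\sum_{j}c_ju_g^{\,j}+\hat T_gF$, where $\hat T_gF:=\sum_{j\ge1}c_jG_{j,\Lambda_g}(gu)$. (For a genuine modular form $F$ of weight $k_0$ this is the $u$-expansion of $g^{k_0}F(gz)+\sum_{\deg\beta<d}F((z+\beta)/g)$.) *)

theory Defs
  imports "HOL-Analysis.Analysis" "HOL-Computational_Algebra.Computational_Algebra"
begin

text \<open>
  Throughout, \<open>'k\<close> is the finite field \<open>F\<^sub>q\<close> (so \<open>q = CARD('k)\<close> and \<open>p = CHAR('k)\<close>), \<open>'k poly\<close> is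
  \<open>A = F\<^sub>q[\<theta>]\<close>, and \<open>'k fls\<close> is \<open>F\<^sub>q((1/\<theta>))\<close>: the variable \<^const>\<open>fls_X\<close> stands for \<open>1/\<theta>\<close> and
  \<^const>\<open>fls_X_inv\<close> for \<open>\<theta>\<close>.
\<close>

text \<open>
  \<open>C\<^sub>\<infinity>\<close> is characterised up to isometric isomorphism over \<open>F\<^sub>q((1/\<theta>))\<close>: a complete, algebraically
  closed field whose metric comes from a non-archimedean absolute value \<open>|x| = dist x 0\<close>, with an
  embedding of \<open>F\<^sub>q((1/\<theta>))\<close> that respects the absolute value (\<open>|\<theta>| = q\<close>) and is such that the elements
  algebraic over the image are dense. Completeness and algebraic closedness are carried by the sort.
\<close>

locale C_infinity =
  fixes emb :: "'k::{field,finite} fls \<Rightarrow> 'c::{alg_closed_field,complete_space}"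
  assumes emb_1: "emb 1 = 1"
    and emb_add: "emb (x + y) = emb x + emb y"
    and emb_mult: "emb (x * y) = emb x * emb y"
    and dist_diff: "dist (a :: 'c) b = dist (a - b) 0"
    and abs_mult: "dist (a * b :: 'c) 0 = dist a 0 * dist b 0"
    and abs_ultra: "dist (a + b :: 'c) 0 \<le> max (dist a 0) (dist b 0)"
    and abs_emb: "x \<noteq> 0 \<Longrightarrow> dist (emb x) 0 = real CARD('k) powi (- fls_subdegree x)"
    and algebraic_dense:
      "closure {c :: 'c. \<exists>P :: 'k fls poly. P \<noteq> 0 \<and> poly (map_poly emb P) c = 0} = UNIV"

definition theta :: "('k::{field,finite} fls \<Rightarrow> 'c::{alg_closed_field,complete_space}) \<Rightarrow> 'c" where
  "theta emb = emb fls_X_inv"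

text \<open>The inclusion of \<open>A\<close> into \<open>C\<^sub>\<infinity>\<close>, i.e.\ evaluation at \<open>\<theta>\<close>.\<close>

definition ofA ::
  "('k::{field,finite} fls \<Rightarrow> 'c::{alg_closed_field,complete_space}) \<Rightarrow> 'k poly \<Rightarrow> 'c" where
  "ofA emb a = poly (map_poly (\<lambda>c. emb (fls_const c)) a) (theta emb)"

text \<open>
  The Carlitz module \<open>C\<^sub>a(x)\<close>: the \<open>F\<^sub>q\<close>-algebra homomorphism \<open>a \<mapsto> C\<^sub>a\<close> determined by
  \<open>C\<^sub>\<theta>(x) = \<theta>x + x\<^sup>q\<close>.
\<close>

definition carlitz ::
  "('k::{field,finite} fls \<Rightarrow> 'c::{alg_closed_field,complete_space}) \<Rightarrow> 'k poly \<Rightarrow> 'c \<Rightarrow> 'c" where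
  "carlitz emb a x =
     (\<Sum>i\<le>degree a. emb (fls_const (coeff a i)) * ((\<lambda>y. theta emb * y + y ^ CARD('k)) ^^ i) x)"

definition division_points ::
  "('k::{field,finite} fls \<Rightarrow> 'c::{alg_closed_field,complete_space}) \<Rightarrow> 'k poly \<Rightarrow> 'c set" where
  "division_points emb a = {x. carlitz emb a x = 0}"

text \<open>The product over \<open>\<Lambda> - {0}\<close> is the unconditional limit of its finite subproducts.\<close>

definition lattice_exp :: "'c::{alg_closed_field,complete_space} set \<Rightarrow> 'c \<Rightarrow> 'c" where
  "lattice_exp \<Lambda> z = z * Lim (finite_subsets_at_top (\<Lambda> - {0})) (\<lambda>S. \<Prod>l\<in>S. 1 - z / l)"

definition goss_poly :: "nat \<Rightarrow> 'c::{alg_closed_field,complete_space} set \<Rightarrow> 'c poly" where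
  "goss_poly j \<Lambda> = (THE G. lead_coeff G = 1 \<and> degree G = j \<and>
     (\<forall>z. z \<notin> \<Lambda> \<longrightarrow>
        ((\<lambda>l. inverse ((z + l) ^ j)) has_sum poly G (inverse (lattice_exp \<Lambda> z))) \<Lambda>))"

definition lattice_of ::
  "('k::{field,finite} fls \<Rightarrow> 'c::{alg_closed_field,complete_space}) \<Rightarrow> 'c \<Rightarrow> 'c set" where
  "lattice_of emb w = range (\<lambda>a. ofA emb a * w)"

text \<open>
  \<open>w\<close> is a period of the Carlitz module if \<open>A w\<close> is the lattice attached to it by the
  analytic uniformisation of Drinfeld modules, i.e.\ \<open>e(az) = C\<^sub>a(e(z))\<close> for \<open>e = e\<^bsub>Aw\<^esub>\<close>; then
  \<open>e\<close> is the Carlitz exponential. Such \<open>w\<close> is unique up to a factor in \<open>F\<^sub>q\<^sup>*\<close>.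
\<close>

definition carlitz_period ::
  "('k::{field,finite} fls \<Rightarrow> 'c::{alg_closed_field,complete_space}) \<Rightarrow> 'c \<Rightarrow> bool" where
  "carlitz_period emb w \<longleftrightarrow> w \<noteq> 0 \<and>
     (\<forall>a z. lattice_exp (lattice_of emb w) (ofA emb a * z)
          = carlitz emb a (lattice_exp (lattice_of emb w) z))"

definition u_param ::
  "('k::{field,finite} fls \<Rightarrow> 'c::{alg_closed_field,complete_space}) \<Rightarrow> 'c \<Rightarrow> 'c \<Rightarrow> 'c" where
  "u_param emb w z = inverse (lattice_exp (lattice_of emb w) (w * z))"

text \<open>
  The expansion of a function \<open>f\<close> as a power series in \<open>u\<close>, valid for small \<open>|u(z)|\<close>. As
  \<^const>\<open>inverse\<close> is total, the poles of \<open>u\<close> are excluded by \<open>u(z) \<noteq> 0\<close>.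
\<close>

definition u_expansion ::
  "('k::{field,finite} fls \<Rightarrow> 'c::{alg_closed_field,complete_space}) \<Rightarrow> 'c \<Rightarrow> ('c \<Rightarrow> 'c) \<Rightarrow> 'c fps" where
  "u_expansion emb w f = (THE F. \<exists>r>0. \<forall>z. u_param emb w z \<noteq> 0 \<and> dist (u_param emb w z) 0 < r \<longrightarrow>
     (\<lambda>j. fps_nth F j * u_param emb w z ^ j) sums f z)"

definition u_at ::
  "('k::{field,finite} fls \<Rightarrow> 'c::{alg_closed_field,complete_space}) \<Rightarrow> 'c \<Rightarrow> 'k poly \<Rightarrow> 'c fps" where
  "u_at emb w a = u_expansion emb w (\<lambda>z. u_param emb w (ofA emb a * z))"

definition goss_u ::
  "('k::{field,finite} fls \<Rightarrow> 'c::{alg_closed_field,complete_space}) \<Rightarrow> 'c \<Rightarrow> nat \<Rightarrow> 'k poly \<Rightarrow> 'c fps" where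
  "goss_u emb w n a = poly (map_poly fps_const (goss_poly n (lattice_of emb w))) (u_at emb w a)"

text \<open>Infinite sums of power series refer to the \<open>u\<close>-adic topology on \<^typ>\<open>'c fps\<close>.\<close>

definition hecke_hat ::
  "('k::{field,finite} fls \<Rightarrow> 'c::{alg_closed_field,complete_space}) \<Rightarrow> 'k poly \<Rightarrow> 'c fps \<Rightarrow> 'c fps" where
  "hecke_hat emb g F = (\<Sum>\<^sub>\<infinity>j\<in>{1..}. fps_const (fps_nth F j) *
     fps_of_poly (pcompose (goss_poly j (division_points emb g)) [:0, ofA emb g:]))"

definition hecke ::
  "('k::{field,finite} fls \<Rightarrow> 'c::{alg_closed_field,complete_space}) \<Rightarrow> 'c \<Rightarrow> nat \<Rightarrow> 'k poly \<Rightarrow>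
     'c fps \<Rightarrow> 'c fps" where
  "hecke emb w k\<^sub>0 g F =
     fps_const (ofA emb g ^ k\<^sub>0) * (\<Sum>\<^sub>\<infinity>j. fps_const (fps_nth F j) * u_at emb w g ^ j)
     + hecke_hat emb g F"

end

theory Submission
  imports Defs
begin

text \<open>
  For \<open>g\<close> prime, \<^const>\<open>hecke_hat\<close> is a trace: composed with the series \<open>u\<^sub>g\<close> it becomes
  \<open>F \<mapsto> \<Sum> F(1/(1/u + \<mu>))\<close> over the \<open>g\<close>-torsion points \<open>\<mu>\<close>, because \<open>C\<^sub>g\<close> is \<open>g\<close> times the
  exponential polynomial of the torsion. Since \<open>u\<^sub>a\<close> is \<open>1/C\<^sub>a(1/u)\<close>, translating \<open>u\<close> by \<open>\<mu>\<close>
  translates \<open>u\<^sub>a\<close> by \<open>C\<^sub>a(\<mu>)\<close>. If \<open>g\<close> divides \<open>a\<close>, all \<open>q\<^sup>d\<close> translates of \<open>G\<^sub>n(u\<^sub>a)\<close> agree and their sum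
  vanishes. Otherwise \<open>C\<^sub>a\<close> permutes the torsion, and the distribution relation of \<open>G\<^sub>n\<close>, i.e.\ the
  splitting of a sum over \<open>A\<close> into residue classes modulo \<open>g\<close>, gives \<open>g\<^sup>n G\<^sub>n(u\<^sub>a)\<close>. So the trace
  contributes the terms with \<open>g\<close> not dividing \<open>a\<close>, and \<open>g\<^bsup>k\<^sub>0\<^esup> f(u\<^sub>g)\<close> those with \<open>g\<close> dividing \<open>a\<close>.
\<close>

text \<open>\<open>goss_poly\<close> and \<open>u_at\<close> are definite descriptions, so existence
  and uniqueness have to be settled before any computation. Existence for an infinite lattice is a
  limit over its balls, which the ultrametric inequality makes finite subgroups; for a finite
  subgroup the sum over translates comes from a partial fraction identity. Uniqueness, and the basic
  identities between series, are tested on the values of u: these accumulate at 0, and a power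
  series is determined by its values on such a set. Identities that are awkward for coefficients,
  such as C_ab = C_a o C_b, thus reduce to the functional equation of the exponential. The trace is
  only visible after the substitution of u_g for u. Nothing is lost by it, because substituting a
  nonzero series without constant term is injective. The factor g^n has two origins. In the trace it
  is the scaling of 1/(z + l)^n when the lattice A w is divided by g; in the other part it is what
  remains of g^k0 once g^(k0-n) is absorbed into (g a)^(k0-n).\<close>

no_notation vec_nth (infixl "$" 90)

section \<open>Finite additive subgroups\<close>

definition additive_subgroup :: "'a::ab_group_add set \<Rightarrow> bool" where
  "additive_subgroup S \<longleftrightarrow> 0 \<in> S \<and> (\<forall>x\<in>S. \<forall>y\<in>S. x - y \<in> S)"

lemma additive_subgroup_0: "additive_subgroup S \<Longrightarrow> 0 \<in> S"
  by (simp add: additive_subgroup_def)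

lemma additive_subgroup_diff: "additive_subgroup S \<Longrightarrow> x \<in> S \<Longrightarrow> y \<in> S \<Longrightarrow> x - y \<in> S"
  by (simp add: additive_subgroup_def)

lemma additive_subgroup_minus: "additive_subgroup S \<Longrightarrow> x \<in> S \<Longrightarrow> - x \<in> S"
  using additive_subgroup_diff[of S 0 x] additive_subgroup_0[of S] by simp

lemma additive_subgroup_add: "additive_subgroup S \<Longrightarrow> x \<in> S \<Longrightarrow> y \<in> S \<Longrightarrow> x + y \<in> S"
  using additive_subgroup_diff[of S x "- y"] additive_subgroup_minus[of S y] by simp

text \<open>The exponential of a finite lattice, normalised to linear coefficient 1 rather than to
  be monic: this normalisation survives the limit over growing finite subgroups.\<close>

definition expo :: "'a::field set \<Rightarrow> 'a poly" where
  "expo S = [:0, 1:] * (\<Prod>l\<in>S - {0}. [:1, - inverse l:])"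

lemma poly_expo: "poly (expo S) z = z * (\<Prod>l\<in>S - {0}. 1 - z / l)"
  by (simp add: expo_def poly_prod divide_inverse)

lemma poly_expo_eq_0_iff:
  assumes "finite S" "0 \<in> S"
  shows "poly (expo S) z = 0 \<longleftrightarrow> z \<in> S"
proof -
  have "(\<exists>l\<in>S - {0}. 1 - z / l = 0) \<longleftrightarrow> z \<in> S - {0}"
    by force
  thus ?thesis using assms by (auto simp: poly_expo)
qed

lemma degree_expo:
  assumes "finite S" "0 \<in> S"
  shows "degree (expo S) = card S"
proof -
  have "degree (\<Prod>l\<in>S - {0}. [:1, - inverse l:]) = (\<Sum>l\<in>S - {0}. degree [:1, - inverse l:])"
    by (rule degree_prod_eq_sum_degree) auto
  also have "\<dots> = (\<Sum>l\<in>S - {0}. 1)"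
    by (rule sum.cong) auto
  also have "\<dots> = card S - 1" using assms by simp
  finally have d: "degree (\<Prod>l\<in>S - {0}. [:1, - inverse l:]) = card S - 1" .
  have nz: "(\<Prod>l\<in>S - {0}. [:1, - inverse l:]) \<noteq> 0"
    using assms by simp
  have "card S > 0" using assms by (auto simp: card_gt_0_iff)
  thus ?thesis using d nz unfolding expo_def by (subst degree_mult_eq) auto
qed

lemma coeff_expo_0: "coeff (expo S) 0 = 0"
  by (simp add: expo_def)

lemma coeff_expo_1: "coeff (expo S) 1 = 1"
proof -
  have "coeff (\<Prod>l\<in>S - {0}. [:1, - inverse l:]) 0 = 1"
    by (simp add: poly_0_coeff_0[symmetric] poly_prod)
  thus ?thesis by (simp add: expo_def)
qed

text \<open>Both sides below have degree \<open>card S\<close>, the same leading coefficient, and agree on \<open>S\<close>.\<close>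

lemma pcompose_expo:
  assumes S: "finite S" "additive_subgroup S"
  shows "pcompose (expo S) [:y, 1:] = expo S + [:poly (expo S) y:]"
proof -
  have S0: "0 \<in> S" using S additive_subgroup_0 by blast
  have cS: "card S > 0" using S S0 by (auto simp: card_gt_0_iff)
  note deg = degree_expo[OF S(1) S0]
  \<comment> \<open>Used twice: with y in \<open>S\<close> and c = 0 it gives invariance under
    \<open>S\<close>, and by that invariance every y qualifies with c = e(y).\<close>
  have *: "pcompose (expo S) [:y, 1:] = expo S + [:c:]"
    if c: "\<And>x. x \<in> S \<Longrightarrow> poly (expo S) (y + x) = c" for y c
  proof (rule poly_eqI_degree_lead_coeff[where n = "card S" and A = S])
    have dp: "degree (pcompose (expo S) [:y, 1:]) = card S"
      by (simp add: degree_pcompose deg)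
    have "lead_coeff (pcompose (expo S) [:y, 1:]) = lead_coeff (expo S)"
      by (subst lead_coeff_comp) auto
    thus "coeff (pcompose (expo S) [:y, 1:]) (card S) = coeff (expo S + [:c:]) (card S)"
      using dp deg cS by (simp add: coeff_pCons split: nat.splits)
    show "degree (pcompose (expo S) [:y, 1:]) \<le> card S" using dp by simp
    show "degree (expo S + [:c:]) \<le> card S"
      using deg by (intro degree_add_le) auto
    show "poly (pcompose (expo S) [:y, 1:]) z = poly (expo S + [:c:]) z" if "z \<in> S" for z
      using c[OF that] that poly_expo_eq_0_iff[OF S(1) S0, of z]
      by (simp add: poly_pcompose)
  qed auto
  have shift: "poly (expo S) (y + l) = poly (expo S) y" if "l \<in> S" for l y
  proof -
    have "pcompose (expo S) [:l, 1:] = expo S + [:0:]"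
      using that S S0 by (intro *) (auto simp: poly_expo_eq_0_iff additive_subgroup_add)
    hence "poly (pcompose (expo S) [:l, 1:]) y = poly (expo S) y" by simp
    thus ?thesis by (simp add: poly_pcompose add.commute)
  qed
  show ?thesis by (rule *) (simp add: shift)
qed

lemma poly_expo_add:
  assumes "finite S" "additive_subgroup S"
  shows "poly (expo S) (x + y) = poly (expo S) x + poly (expo S) y"
  using arg_cong[OF pcompose_expo[OF assms, of y], of "\<lambda>p. poly p x"]
  by (simp add: poly_pcompose add.commute)

text \<open>By additivity e(X + y) and e(X) differ by a constant, so the derivative is invariant
  under every translation and equals its value at 0, the linear coefficient.\<close>

lemma poly_pderiv_expo:
  assumes "finite S" "additive_subgroup S"
  shows "poly (pderiv (expo S)) y = 1"
proof -
  have "pderiv (pcompose (expo S) [:y, 1:]) = pderiv (expo S)"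
    by (simp add: pcompose_expo[OF assms] pderiv_add pderiv_pCons)
  hence "pcompose (pderiv (expo S)) [:y, 1:] = pderiv (expo S)"
    by (simp add: pderiv_pcompose pderiv_pCons)
  hence "poly (pcompose (pderiv (expo S)) [:y, 1:]) 0 = poly (pderiv (expo S)) 0" by simp
  thus ?thesis
    using coeff_expo_1[of S] by (simp add: poly_pcompose poly_0_coeff_0 coeff_pderiv)
qed

text \<open>With \<open>e = expo S\<close>, the inverse of \<open>e(z) - e(T)\<close> is the sum over \<open>S\<close> of \<open>1/(z + l - T)\<close>: the
  cofactors \<open>Q l\<close> below sum to \<open>1\<close>, since their sum takes the value \<open>1\<close> at each \<open>z + l\<close>.\<close>

lemma expo_partial_fractions:
  assumes S: "finite S" "additive_subgroup S"
  shows "\<exists>Q. (\<forall>l\<in>S. [:poly (expo S) z:] - expo S = [:z + l, -1:] * Q l) \<and> (\<Sum>l\<in>S. Q l) = 1"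
proof -
  define B where "B = [:poly (expo S) z:] - expo S"
  have S0: "0 \<in> S" using S additive_subgroup_0 by blast
  have cS: "card S > 0" using S S0 by (auto simp: card_gt_0_iff)
  have B_root: "poly B (z + l) = 0" if "l \<in> S" for l
    using that S S0 poly_expo_eq_0_iff[OF S(1) S0, of l] by (simp add: B_def poly_expo_add)
  have "\<exists>q. B = [:z + l, -1:] * q" if "l \<in> S" for l
  proof -
    have "[:- (z + l), 1:] dvd B" using B_root[OF that] by (simp add: poly_eq_0_iff_dvd)
    then obtain q where "B = [:- (z + l), 1:] * q" by (auto simp: dvd_def)
    moreover have "[:- (z + l), 1:] = - [:z + l, -1:]" by simp
    ultimately have "B = [:z + l, -1:] * (- q)" by (metis minus_mult_commute)
    thus ?thesis by blast
  qed
  then obtain Q where Q: "\<And>l. l \<in> S \<Longrightarrow> B = [:z + l, -1:] * Q l" by metis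
  have degB: "degree B = card S"
  proof -
    have "degree B = degree (expo S - [:poly (expo S) z:])"
      by (metis B_def degree_minus minus_diff_eq)
    also have "\<dots> = card S"
      using degree_expo[OF S(1) S0] cS
      by (metis degree_add_eq_left degree_minus degree_pCons_0 diff_conv_add_uminus)
    finally show ?thesis .
  qed
  have degQ: "degree (Q l) < card S" if "l \<in> S" for l
  proof -
    have "Q l \<noteq> 0" using Q[OF that] degB cS by auto
    hence "degree B = 1 + degree (Q l)"
      by (subst Q[OF that], subst degree_mult_eq) auto
    thus ?thesis using degB by simp
  qed
  \<comment> \<open>At the root T = z + l of B the product rule leaves only - Q l, while B' = - e' =
    - 1.\<close>
  have diag: "poly (Q l) (z + l) = 1" if "l \<in> S" for l
  proof -
    have "pderiv B = [:z + l, -1:] * pderiv (Q l) - Q l"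
      unfolding Q[OF that] pderiv_mult by (simp add: pderiv_pCons)
    hence "poly (pderiv B) (z + l) = - poly (Q l) (z + l)" by simp
    moreover have "poly (pderiv B) (z + l) = - 1"
      by (simp add: B_def pderiv_diff poly_pderiv_expo[OF S] pderiv_pCons)
    ultimately show ?thesis by simp
  qed
  have off: "poly (Q l) (z + m) = 0" if "l \<in> S" "m \<in> S" "l \<noteq> m" for l m
    using B_root[OF that(2)] that Q[OF that(1)] by simp
  have "(\<Sum>l\<in>S. Q l) = 1"
  proof (rule poly_eqI_degree[where A = "(+) z ` S"])
    have cA: "card ((+) z ` S) = card S" by (rule card_image) auto
    show "degree (\<Sum>l\<in>S. Q l) < card ((+) z ` S)"
      unfolding cA using degQ cS by (intro degree_sum_less) auto
    show "degree 1 < card ((+) z ` S)" using cA cS by simp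
    fix x assume "x \<in> (+) z ` S"
    then obtain m where m: "m \<in> S" "x = z + m" by auto
    have "poly (\<Sum>l\<in>S. Q l) x = (\<Sum>l\<in>S. if l = m then 1 else 0)"
      unfolding poly_sum using m diag off by (intro sum.cong) auto
    thus "poly (\<Sum>l\<in>S. Q l) x = poly 1 x" using m S by simp
  qed
  thus ?thesis using Q unfolding B_def by blast
qed

text \<open>With c i the coefficient of T^(j-1) in e(T)^i this is Goss's formula: G_j(X) is the
  coefficient of T^(j-1) in X / (1 - X e(T)). Leaving c open lets the same polynomial serve for
  limits of such coefficients.\<close>

definition goss_sum :: "nat \<Rightarrow> (nat \<Rightarrow> 'a::comm_ring_1) \<Rightarrow> 'a poly" where
  "goss_sum j c = (\<Sum>i<j. monom (c i) (Suc i))"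

lemma coeff_goss_sum: "coeff (goss_sum j c) k = (if 0 < k \<and> k \<le> j then c (k - 1) else 0)"
proof -
  have "coeff (goss_sum j c) k = (\<Sum>i<j. if i = k - 1 then (if k > 0 then c i else 0) else 0)"
    unfolding goss_sum_def coeff_sum by (rule sum.cong) auto
  also have "\<dots> = (if k - 1 < j then (if k > 0 then c (k - 1) else 0) else 0)"
    by simp
  finally show ?thesis by (cases k) auto
qed

lemma poly_goss_sum: "poly (goss_sum j c) x = (\<Sum>i<j. c i * x ^ Suc i)"
  by (simp add: goss_sum_def poly_sum poly_monom)

lemma degree_goss_sum:
  fixes c :: "nat \<Rightarrow> 'a::comm_ring_1"
  assumes "j > 0" "c (j - 1) = 1"
  shows "degree (goss_sum j c) = j" "lead_coeff (goss_sum j c) = 1"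
proof -
  show d: "degree (goss_sum j c) = j"
    using assms by (intro antisym degree_le le_degree) (auto simp: coeff_goss_sum)
  show "lead_coeff (goss_sum j c) = 1" unfolding d using assms by (simp add: coeff_goss_sum)
qed

text \<open>As e(T) = T + ..., the power e^i begins with T^i. This makes the Goss polynomials monic,
  also after a passage to the limit.\<close>

lemma coeff_expo_power: "coeff (expo S ^ i) i = 1"
proof -
  define W where "W = (\<Prod>l\<in>S - {0}. [:1, - inverse l:])"
  have "coeff (W ^ i) 0 = 1"
    by (simp add: W_def poly_0_coeff_0[symmetric] poly_prod)
  moreover have "expo S ^ i = monom 1 i * W ^ i"
    unfolding expo_def W_def[symmetric] power_mult_distrib by (simp add: monom_altdef)
  ultimately show ?thesis by (simp add: coeff_monom_mult)
qed

lemma fps_inverse_linear_nth: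
  fixes c :: "'a::field"
  assumes "c \<noteq> 0"
  shows "inverse (fps_of_poly [:c, -1:]) $ k = inverse (c ^ Suc k)"
proof -
  have "fps_of_poly [:c, -1:] * Abs_fps (\<lambda>k. inverse (c ^ Suc k)) = 1"
  proof (rule fps_ext)
    fix n
    show "(fps_of_poly [:c, -1:] * Abs_fps (\<lambda>k. inverse (c ^ Suc k))) $ n = 1 $ n"
      using assms
      by (cases n) (simp_all add: fps_of_poly_pCons algebra_simps)
  qed
  hence "inverse (fps_of_poly [:c, -1:]) = Abs_fps (\<lambda>k. inverse (c ^ Suc k))"
    by (metis fps_inverse_unique)
  thus ?thesis by simp
qed

text \<open>The geometric series for 1/(c - E), cut off at j: the remainder is a multiple of
  (E/c)^j, which has no terms below degree j.\<close>

lemma fps_inverse_const_minus_nth: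
  fixes E :: "'a::field fps"
  assumes "c \<noteq> 0" "E $ 0 = 0" "k < j"
  shows "inverse (fps_const c - E) $ k = (\<Sum>i<j. (E ^ i) $ k * inverse c ^ Suc i)"
proof -
  define r where "r = fps_const (inverse c)"
  define G where "G = (\<Sum>i<j. r ^ Suc i * E ^ i)"
  have r: "fps_const c * r = 1" unfolding r_def using assms by (simp add: fps_const_mult)
  have nz: "(fps_const c - E) $ 0 \<noteq> 0" using assms by simp
  have "(fps_const c - E) * G = 1 - (r * E) ^ j"
  proof -
    have "fps_const c - E = fps_const c * (1 - r * E)"
      using r by (simp add: algebra_simps flip: mult.assoc)
    moreover have "G = r * (\<Sum>i<j. (r * E) ^ i)"
      by (simp add: G_def sum_distrib_left power_mult_distrib mult_ac)
    ultimately have "(fps_const c - E) * G = (fps_const c * r) * ((1 - r * E) * (\<Sum>i<j. (r * E) ^ i))"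
      by (simp add: mult_ac)
    also have "\<dots> = 1 - (r * E) ^ j"
      using r by (simp add: one_diff_power_eq)
    finally show ?thesis .
  qed
  hence "inverse (fps_const c - E) * ((fps_const c - E) * G)
           = inverse (fps_const c - E) * (1 - (r * E) ^ j)" by simp
  hence G: "G = inverse (fps_const c - E) * (1 - (r * E) ^ j)"
    using inverse_mult_eq_1[OF nz] by (metis mult.assoc mult_1)
  have "((r * E) ^ j) $ l = 0" if "l \<le> k" for l
    using assms that by (intro startsby_zero_power_prefix[rule_format]) (auto simp: r_def)
  hence "(inverse (fps_const c - E) * (r * E) ^ j) $ k = 0"
    by (simp add: fps_mult_nth)
  hence "inverse (fps_const c - E) $ k = G $ k"
    by (simp add: G algebra_simps)
  also have "\<dots> = (\<Sum>i<j. (E ^ i) $ k * inverse c ^ Suc i)"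
    unfolding G_def fps_sum_nth r_def fps_const_power fps_mult_left_const_nth by (simp add: mult.commute)
  finally show ?thesis .
qed

text \<open>Compare the coefficients of T^(j-1) in 1/(e(z) - e(T)) = sum of 1/(z + l - T): each
  summand on the right is a geometric series in T, and the left side is one in e(T)/e(z).\<close>

lemma finite_goss_identity:
  assumes S: "finite S" "additive_subgroup S" and z: "z \<notin> S" and j: "j > 0"
  shows "(\<Sum>l\<in>S. inverse ((z + l) ^ j))
       = poly (goss_sum j (\<lambda>i. coeff (expo S ^ i) (j - 1))) (inverse (poly (expo S) z))"
proof -
  define E where "E = fps_of_poly (expo S)"
  define c where "c = poly (expo S) z"
  have S0: "0 \<in> S" using S additive_subgroup_0 by blast
  have c: "c \<noteq> 0" using poly_expo_eq_0_iff[OF S(1) S0] z by (simp add: c_def)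
  have E0: "E $ 0 = 0" by (simp add: E_def coeff_expo_0)
  obtain Q where Q: "\<And>l. l \<in> S \<Longrightarrow> [:c:] - expo S = [:z + l, -1:] * Q l"
    and Q1: "(\<Sum>l\<in>S. Q l) = 1"
    using expo_partial_fractions[OF S] unfolding c_def by blast
  have nz: "z + l \<noteq> 0" if "l \<in> S" for l
    using z that S additive_subgroup_minus[of S l] by (metis add_eq_0_iff2)
  have "(fps_const c - E) * (\<Sum>l\<in>S. inverse (fps_of_poly [:z + l, -1:])) = (\<Sum>l\<in>S. fps_of_poly (Q l))"
    unfolding sum_distrib_left
  proof (rule sum.cong)
    fix l assume l: "l \<in> S"
    have "fps_const c - E = fps_of_poly ([:c:] - expo S)"
      by (simp add: E_def fps_of_poly_diff)
    also have "\<dots> = fps_of_poly [:z + l, -1:] * fps_of_poly (Q l)"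
      unfolding Q[OF l] by (rule fps_of_poly_mult)
    finally have "(fps_const c - E) * inverse (fps_of_poly [:z + l, -1:])
        = (inverse (fps_of_poly [:z + l, -1:]) * fps_of_poly [:z + l, -1:]) * fps_of_poly (Q l)"
      by (simp only: mult_ac)
    moreover have "fps_of_poly [:z + l, -1:] $ 0 \<noteq> 0" using nz[OF l] by simp
    ultimately show "(fps_const c - E) * inverse (fps_of_poly [:z + l, -1:]) = fps_of_poly (Q l)"
      using inverse_mult_eq_1[of "fps_of_poly [:z + l, -1:]"] by (metis mult_1)
  qed auto
  also have "\<dots> = 1" by (simp add: fps_of_poly_sum[symmetric] Q1)
  finally have "inverse (fps_const c - E) = (\<Sum>l\<in>S. inverse (fps_of_poly [:z + l, -1:]))"
    by (metis fps_inverse_unique)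
  hence "(\<Sum>l\<in>S. inverse (fps_of_poly [:z + l, -1:])) $ (j - 1) = (\<Sum>i<j. (E ^ i) $ (j - 1) * inverse c ^ Suc i)"
    using fps_inverse_const_minus_nth[OF c E0, of "j - 1" j] j by simp
  thus ?thesis
    using j nz
    by (simp add: fps_sum_nth fps_inverse_linear_nth poly_goss_sum E_def c_def
        flip: fps_of_poly_power)
qed

section \<open>Lattices over a non-archimedean field\<close>

text \<open>The sort of \<open>'c\<close> does not relate the metric to the field operations. These
  axioms do, and the continuity of addition, multiplication and inversion is derived from
  them.\<close>

locale nonarch_field =
  fixes nrm :: "'c::{alg_closed_field,complete_space} \<Rightarrow> real"
  assumes dist_nrm: "dist a b = nrm (a - b)"
    and nrm_mult: "nrm (a * b) = nrm a * nrm b"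
    and nrm_ultra: "nrm (a + b) \<le> max (nrm a) (nrm b)"
begin

lemma nrm_0 [simp]: "nrm 0 = 0"
  using dist_nrm[of 0 0] by simp

lemma nrm_eq_0_iff [simp]: "nrm x = 0 \<longleftrightarrow> x = 0"
  using dist_nrm[of x 0] by (metis diff_zero dist_eq_0_iff)

lemma nrm_ge_0 [simp]: "nrm x \<ge> 0"
  using dist_nrm[of x 0] by (metis diff_zero zero_le_dist)

lemma nrm_pos_iff [simp]: "nrm x > 0 \<longleftrightarrow> x \<noteq> 0"
  using nrm_ge_0[of x] nrm_eq_0_iff[of x] by linarith

lemma nrm_1 [simp]: "nrm 1 = 1"
  using nrm_mult[of 1 1] by simp

lemma nrm_minus [simp]: "nrm (- x) = nrm x"
  using dist_nrm[of x 0] dist_nrm[of 0 x] by (simp add: dist_commute)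

lemma nrm_minus_commute: "nrm (x - y) = nrm (y - x)"
  using nrm_minus[of "x - y"] by simp

lemma nrm_diff_ultra: "nrm (a - b) \<le> max (nrm a) (nrm b)"
  using nrm_ultra[of a "- b"] by simp

lemma nrm_triangle: "nrm (a + b) \<le> nrm a + nrm b"
  using nrm_ultra[of a b] nrm_ge_0[of a] nrm_ge_0[of b] by linarith

lemma nrm_power: "nrm (x ^ n) = nrm x ^ n"
  by (induction n) (auto simp: nrm_mult)

lemma nrm_inverse: "nrm (inverse x) = inverse (nrm x)"
proof (cases "x = 0")
  case False
  hence "nrm x * nrm (inverse x) = 1" by (simp flip: nrm_mult)
  thus ?thesis using False by (simp add: field_simps)
qed simp

lemma nrm_divide: "nrm (x / y) = nrm x / nrm y"
  by (simp add: divide_inverse nrm_mult nrm_inverse)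

lemma nrm_prod: "nrm (prod f A) = (\<Prod>x\<in>A. nrm (f x))"
  by (induction A rule: infinite_finite_induct) (auto simp: nrm_mult)

lemma nrm_sum_le: "(\<And>x. x \<in> A \<Longrightarrow> nrm (f x) \<le> c) \<Longrightarrow> 0 \<le> c \<Longrightarrow> nrm (sum f A) \<le> c"
proof (induction A rule: infinite_finite_induct)
  case (insert x F)
  have "nrm (f x) \<le> c" "nrm (sum f F) \<le> c" using insert by auto
  hence "nrm (f x + sum f F) \<le> c" using nrm_ultra[of "f x" "sum f F"] by linarith
  thus ?case using insert by simp
qed auto

text \<open>The larger norm wins: the reverse inequality is the ultrametric bound for x = (x + y) -
  y.\<close>

lemma nrm_add_eq: "nrm y < nrm x \<Longrightarrow> nrm (x + y) = nrm x"
  using nrm_ultra[of x y] nrm_diff_ultra[of "x + y" y] by (auto simp: max_def split: if_splits)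

section \<open>Limits with respect to an ultrametric norm\<close>

lemma tendsto_nrm_iff: "(f \<longlongrightarrow> l) F \<longleftrightarrow> ((\<lambda>x. nrm (f x - l)) \<longlongrightarrow> 0) F"
  by (subst tendsto_dist_iff) (simp add: dist_nrm)

lemma tendsto_nrm: "(f \<longlongrightarrow> l) F \<Longrightarrow> ((\<lambda>x. nrm (f x)) \<longlongrightarrow> nrm l) F"
  using tendsto_dist[OF _ tendsto_const, of f l F 0] by (simp add: dist_nrm)

lemma na_tendsto_add:
  fixes f g :: "'b \<Rightarrow> 'c"
  assumes "(f \<longlongrightarrow> a) F" "(g \<longlongrightarrow> b) F"
  shows "((\<lambda>x. f x + g x) \<longlongrightarrow> a + b) F"
  unfolding tendsto_nrm_iff
proof (rule tendsto_sandwich[where f = "\<lambda>_. 0" and h = "\<lambda>x. nrm (f x - a) + nrm (g x - b)"])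
  show "((\<lambda>x. nrm (f x - a) + nrm (g x - b)) \<longlongrightarrow> 0) F"
    using tendsto_add[OF assms[unfolded tendsto_nrm_iff]] by simp
  show "\<forall>\<^sub>F x in F. nrm (f x + g x - (a + b)) \<le> nrm (f x - a) + nrm (g x - b)"
    using nrm_triangle[of "f x - a" "g x - b" for x]
    by (intro always_eventually allI) (metis add_diff_add)
qed auto

lemma na_tendsto_mult:
  fixes f g :: "'b \<Rightarrow> 'c"
  assumes "(f \<longlongrightarrow> a) F" "(g \<longlongrightarrow> b) F"
  shows "((\<lambda>x. f x * g x) \<longlongrightarrow> a * b) F"
  unfolding tendsto_nrm_iff
proof (rule tendsto_sandwich[where f = "\<lambda>_. 0" and
      h = "\<lambda>x. nrm (f x) * nrm (g x - b) + nrm (f x - a) * nrm b"])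
  have "((\<lambda>x. nrm (f x) * nrm (g x - b) + nrm (f x - a) * nrm b) \<longlongrightarrow> nrm a * 0 + 0 * nrm b) F"
    using assms tendsto_nrm[OF assms(1)] unfolding tendsto_nrm_iff by (intro tendsto_intros)
  thus "((\<lambda>x. nrm (f x) * nrm (g x - b) + nrm (f x - a) * nrm b) \<longlongrightarrow> 0) F" by simp
  show "\<forall>\<^sub>F x in F. nrm (f x * g x - a * b) \<le> nrm (f x) * nrm (g x - b) + nrm (f x - a) * nrm b"
  proof (intro always_eventually allI)
    fix x
    have "f x * g x - a * b = f x * (g x - b) + (f x - a) * b" by (simp add: algebra_simps)
    thus "nrm (f x * g x - a * b) \<le> nrm (f x) * nrm (g x - b) + nrm (f x - a) * nrm b"
      using nrm_triangle[of "f x * (g x - b)" "(f x - a) * b"] by (simp only: nrm_mult)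
  qed
qed auto

lemma na_tendsto_inverse:
  fixes f :: "'b \<Rightarrow> 'c"
  assumes "(f \<longlongrightarrow> a) F" "a \<noteq> 0"
  shows "((\<lambda>x. inverse (f x)) \<longlongrightarrow> inverse a) F"
  unfolding tendsto_nrm_iff
proof (rule Lim_transform_eventually)
  have "((\<lambda>x. nrm (f x - a) / (nrm (f x) * nrm a)) \<longlongrightarrow> 0 / (nrm a * nrm a)) F"
    using assms tendsto_nrm[OF assms(1)] unfolding tendsto_nrm_iff by (intro tendsto_intros) auto
  thus "((\<lambda>x. nrm (f x - a) / (nrm (f x) * nrm a)) \<longlongrightarrow> 0) F" by simp
  have "\<forall>\<^sub>F x in F. nrm (f x) > 0"
    using order_tendstoD(1)[OF tendsto_nrm[OF assms(1)], of 0] assms by simp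
  thus "\<forall>\<^sub>F x in F. nrm (f x - a) / (nrm (f x) * nrm a) = nrm (inverse (f x) - inverse a)"
  proof eventually_elim
    case (elim x)
    hence "inverse (f x) - inverse a = (a - f x) / (f x * a)" using assms by (simp add: field_simps)
    thus ?case by (simp add: nrm_divide nrm_mult nrm_minus_commute)
  qed
qed

lemma na_tendsto_sum:
  fixes f :: "'d \<Rightarrow> 'b \<Rightarrow> 'c"
  assumes "\<And>i. i \<in> I \<Longrightarrow> (f i \<longlongrightarrow> a i) F"
  shows "((\<lambda>x. \<Sum>i\<in>I. f i x) \<longlongrightarrow> (\<Sum>i\<in>I. a i)) F"
  using assms by (induction I rule: infinite_finite_induct) (auto intro: na_tendsto_add)

lemma na_tendsto_power:
  fixes f :: "'b \<Rightarrow> 'c"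
  assumes "(f \<longlongrightarrow> a) F"
  shows "((\<lambda>x. f x ^ n) \<longlongrightarrow> a ^ n) F"
  using assms by (induction n) (auto intro: na_tendsto_mult)

text \<open>Two terms close to f m are equally close to each other, so it is enough to compare with
  one fixed term.\<close>

lemma na_convergent:
  assumes "\<And>e. e > 0 \<Longrightarrow> \<exists>m. \<forall>n\<ge>m. nrm (f n - f m) < e"
  obtains p where "f \<longlonglongrightarrow> p"
proof -
  have "Cauchy f"
    unfolding Cauchy_def
  proof (intro allI impI)
    fix e :: real assume "e > 0"
    then obtain m where m: "\<And>n. n \<ge> m \<Longrightarrow> nrm (f n - f m) < e" using assms by blast
    have "dist (f n) (f k) < e" if "n \<ge> m" "k \<ge> m" for n k
      using nrm_diff_ultra[of "f n - f m" "f k - f m"] m[OF that(1)] m[OF that(2)]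
      by (simp add: dist_nrm)
    thus "\<exists>M. \<forall>m\<ge>M. \<forall>n\<ge>M. dist (f m) (f n) < e" by blast
  qed
  thus thesis using that Cauchy_convergent convergent_def by blast
qed

text \<open>Serves for infinite products as well as for sums: \<open>h\<close> is any function of
  finite sets that hardly changes beyond the exhausting sets \<open>B m\<close>. The unconditional
  limit is then the limit along the exhaustion.\<close>

lemma exhaustion_limit:
  fixes h :: "'a set \<Rightarrow> 'c"
  assumes fin: "\<And>m. finite (B m)" and sub: "\<And>m. B m \<subseteq> A"
    and mono: "\<And>m n :: nat. m \<le> n \<Longrightarrow> B m \<subseteq> B n"
    and small: "\<And>e. e > 0 \<Longrightarrow> \<exists>m. \<forall>S. finite S \<and> B m \<subseteq> S \<and> S \<subseteq> A \<longrightarrow> nrm (h S - h (B m)) < e"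
  obtains p where "(\<lambda>m. h (B m)) \<longlonglongrightarrow> p" "(h \<longlongrightarrow> p) (finite_subsets_at_top A)"
proof -
  obtain p where p: "(\<lambda>m. h (B m)) \<longlonglongrightarrow> p"
  proof (rule na_convergent)
    fix e :: real assume "e > 0"
    from small[OF this] obtain m
      where m: "\<forall>S. finite S \<and> B m \<subseteq> S \<and> S \<subseteq> A \<longrightarrow> nrm (h S - h (B m)) < e" ..
    have "nrm (h (B n) - h (B m)) < e" if "m \<le> n" for n
      using m[rule_format, of "B n"] fin[of n] sub[of n] mono[OF that] by simp
    thus "\<exists>m. \<forall>n\<ge>m. nrm (h (B n) - h (B m)) < e" by auto
  qed
  have "(h \<longlongrightarrow> p) (finite_subsets_at_top A)"
  proof (rule tendstoI)
    fix e :: real assume e: "e > 0"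
    from small[OF this] obtain m
      where m: "\<forall>S. finite S \<and> B m \<subseteq> S \<and> S \<subseteq> A \<longrightarrow> nrm (h S - h (B m)) < e" ..
    have "\<forall>\<^sub>F n in sequentially. dist (h (B n)) p < e \<and> n \<ge> m"
      using tendstoD[OF p e] eventually_ge_at_top[of m] by eventually_elim auto
    then obtain n where n: "dist (h (B n)) p < e" "n \<ge> m"
      using eventually_happens[of _ sequentially] by auto
    have "dist (h S) p < e" if S: "finite S" "B m \<subseteq> S" "S \<subseteq> A" for S
    proof -
      have "nrm (h S - h (B m)) < e" using m S by simp
      moreover have "nrm (h (B n) - h (B m)) < e"
        using m[rule_format, of "B n"] fin[of n] sub[of n] mono[OF n(2)] by simp
      ultimately have "nrm (h S - h (B n)) < e"
        using nrm_diff_ultra[of "h S - h (B m)" "h (B n) - h (B m)"] by simp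
      thus ?thesis using n(1) nrm_ultra[of "h S - h (B n)" "h (B n) - p"] by (simp add: dist_nrm)
    qed
    thus "\<forall>\<^sub>F S in finite_subsets_at_top A. dist (h S) p < e"
      unfolding eventually_finite_subsets_at_top using fin[of m] sub[of m] by (intro exI[of _ "B m"]) simp
  qed
  with p that show thesis by blast
qed

text \<open>The bound by 1 on the product itself feeds the induction: a new factor 1 - x changes the
  product R by x R, which is small only if R is bounded.\<close>

lemma prod_near_1:
  assumes "finite T" "\<And>l. l \<in> T \<Longrightarrow> nrm (x l) \<le> d" "0 \<le> d" "d \<le> 1"
  shows "nrm ((\<Prod>l\<in>T. 1 - x l) - 1) \<le> d \<and> nrm (\<Prod>l\<in>T. 1 - x l) \<le> 1"
  using assms
proof (induction T)
  case (insert a T)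
  define R where "R = (\<Prod>l\<in>T. 1 - x l)"
  have R: "nrm (R - 1) \<le> d" "nrm R \<le> 1" using insert unfolding R_def by auto
  have eq: "(\<Prod>l\<in>insert a T. 1 - x l) = R - x a * R"
    using insert by (simp add: R_def algebra_simps)
  have xR: "nrm (x a * R) \<le> d"
    unfolding nrm_mult using mult_mono[of "nrm (x a)" d "nrm R" 1] R insert.prems by simp
  have "nrm (R - x a * R - 1) \<le> d"
    using nrm_diff_ultra[of "R - 1" "x a * R"] R xR by (simp add: algebra_simps)
  moreover have "nrm (R - x a * R) \<le> 1"
    using nrm_diff_ultra[of R "x a * R"] R(2) xR \<open>d \<le> 1\<close> by linarith
  ultimately show ?case unfolding eq by blast
qed auto

section \<open>Discrete subgroups and their exponentials\<close>

definition discrete_subgroup :: "'c set \<Rightarrow> bool" where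
  "discrete_subgroup L \<longleftrightarrow> additive_subgroup L \<and> (\<forall>r. finite {l \<in> L. nrm l \<le> r})"

text \<open>A ball in the lattice. By the ultrametric inequality it is a subgroup, and discreteness
  makes it finite, so the results on finite subgroups apply to it.\<close>

definition trunc :: "'c set \<Rightarrow> nat \<Rightarrow> 'c set" where
  "trunc L m = {l \<in> L. nrm l \<le> real m}"

context
  fixes L :: "'c set"
  assumes L: "discrete_subgroup L"
begin

lemma discrete_subgroup_additive: "additive_subgroup L"
  using L by (simp add: discrete_subgroup_def)

lemma finite_trunc: "finite (trunc L m)"
  using L by (simp add: discrete_subgroup_def trunc_def)

lemma trunc_subset: "trunc L m \<subseteq> L"
  by (auto simp: trunc_def)

lemma trunc_mono: "m \<le> n \<Longrightarrow> trunc L m \<subseteq> trunc L n"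
  by (auto simp: trunc_def)

lemma additive_subgroup_trunc: "additive_subgroup (trunc L m)"
  using discrete_subgroup_additive nrm_diff_ultra
  by (auto simp: additive_subgroup_def trunc_def intro: order.trans[OF nrm_diff_ultra])

lemma zero_in_trunc: "0 \<in> trunc L m"
  using additive_subgroup_trunc additive_subgroup_0 by blast

text \<open>Beyond a radius m \<ge> m0 every omitted factor 1 - z/l has |z/l| \<le> |z|/m < 1. The
  tail product is thus within |z|/m of 1, which gives convergence, and has norm exactly 1, so the
  norm of the full product is already that of the truncation at m0.\<close>

lemma lattice_exp_truncation:
  assumes m0: "real m0 > nrm z"
  shows "(\<lambda>m. poly (expo (trunc L m)) z) \<longlonglongrightarrow> lattice_exp L z"
    and "nrm (lattice_exp L z) = nrm (poly (expo (trunc L m0)) z)"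
proof -
  define h where "h S = (\<Prod>l\<in>S. 1 - z / l)" for S
  define B where "B m = trunc L m - {0}" for m
  define K where "K = nrm (h (B m0))"
  have m0_pos: "m0 > 0" using m0 nrm_ge_0[of z] by (metis not_gr_zero of_nat_0 not_le)
  have K: "K \<ge> 0" by (simp add: K_def)
  have tail: "nrm (h (S - B m) - 1) \<le> nrm z / m \<and> nrm (h (S - B m)) \<le> 1"
    if "m \<ge> m0" "finite S" "S \<subseteq> L - {0}" for m S
    unfolding h_def
  proof (rule prod_near_1)
    have m: "real m \<ge> real m0" "real m > 0" using that m0_pos by auto
    show "nrm z / real m \<le> 1" using m0 m by simp
    fix l assume "l \<in> S - B m"
    hence "nrm l > real m" using that by (auto simp: B_def trunc_def)
    thus "nrm (z / l) \<le> nrm z / real m" using m by (simp add: nrm_divide frac_le)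
  qed (use that in auto)
  have tail1: "nrm (h (S - B m)) = 1" if "m \<ge> m0" "finite S" "S \<subseteq> L - {0}" for m S
  proof -
    have "real m \<ge> real m0" "real m > 0" using that m0_pos by auto
    hence "nrm z / real m < 1" using m0 by simp
    hence "nrm (h (S - B m) - 1) < nrm 1" using tail[OF that] by simp
    from nrm_add_eq[OF this] show ?thesis by simp
  qed
  have split: "h S = h (B m) * h (S - B m)" if "finite S" "B m \<subseteq> S" for m S
    unfolding h_def using that prod.subset_diff[of "B m" S] by (simp add: mult.commute)
  have B_fin: "finite (B m)" for m using finite_trunc by (simp add: B_def)
  have B_sub: "B m \<subseteq> L - {0}" for m using trunc_subset by (auto simp: B_def)
  have B_mono: "B m \<subseteq> B n" if "m \<le> n" for m n using trunc_mono[OF that] by (auto simp: B_def)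
  have Bm: "nrm (h (B m)) = K" if "m \<ge> m0" for m
    using split[OF B_fin B_mono[OF that]] tail1[OF order.refl B_fin B_sub]
    by (simp add: nrm_mult K_def)
  obtain p where p: "(\<lambda>m. h (B m)) \<longlonglongrightarrow> p" "(h \<longlongrightarrow> p) (finite_subsets_at_top (L - {0}))"
  proof (rule exhaustion_limit[of B "L - {0}" h])
    fix e :: real assume e: "e > 0"
    obtain m where m: "real m > K * nrm z / e" "m \<ge> m0"
      by (metis reals_Archimedean2 max.cobounded1 max.cobounded2 of_nat_le_iff order.strict_trans2)
    have "nrm (h S - h (B m)) < e" if S: "finite S" "B m \<subseteq> S" "S \<subseteq> L - {0}" for S
    proof -
      have mp: "real m > 0" using m m0_pos by simp
      have "h S - h (B m) = h (B m) * (h (S - B m) - 1)"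
        using split[OF S(1,2)] by (simp add: algebra_simps)
      hence "nrm (h S - h (B m)) \<le> K * (nrm z / m)"
        using Bm[OF m(2)] tail[OF m(2) S(1,3)] mult_left_mono[OF _ K] by (simp only: nrm_mult)
      also have "\<dots> < e" using m(1) mp e by (simp add: field_simps)
      finally show ?thesis .
    qed
    thus "\<exists>m. \<forall>S. finite S \<and> B m \<subseteq> S \<and> S \<subseteq> L - {0} \<longrightarrow> nrm (h S - h (B m)) < e" by blast
  qed (use B_fin B_sub B_mono in auto)
  have e: "lattice_exp L z = z * p"
    unfolding lattice_exp_def h_def[symmetric]
    using tendsto_Lim[OF finite_subsets_at_top_neq_bot p(2)] by (simp add: h_def[abs_def])
  have pe: "poly (expo (trunc L m)) z = z * h (B m)" for m
    by (simp add: poly_expo h_def B_def)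
  show "(\<lambda>m. poly (expo (trunc L m)) z) \<longlonglongrightarrow> lattice_exp L z"
    unfolding pe e by (intro na_tendsto_mult tendsto_const p)
  have "(\<lambda>m. nrm (h (B m))) \<longlonglongrightarrow> K"
    by (rule tendsto_eventually) (use Bm in \<open>auto simp: eventually_sequentially\<close>)
  hence "nrm p = K" using tendsto_nrm[OF p(1)] LIMSEQ_unique by blast
  thus "nrm (lattice_exp L z) = nrm (poly (expo (trunc L m0)) z)"
    by (simp add: e pe K_def nrm_mult)
qed

lemma lattice_exp_LIMSEQ: "(\<lambda>m. poly (expo (trunc L m)) z) \<longlonglongrightarrow> lattice_exp L z"
  using reals_Archimedean2[of "nrm z"] lattice_exp_truncation by blast

text \<open>The norm is attained at a finite truncation, so vanishing is decided by a polynomial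
  whose roots are known.\<close>

lemma lattice_exp_eq_0_iff: "lattice_exp L z = 0 \<longleftrightarrow> z \<in> L"
proof -
  obtain m where m: "real m > nrm z" using reals_Archimedean2 by blast
  have "lattice_exp L z = 0 \<longleftrightarrow> poly (expo (trunc L m)) z = 0"
    using lattice_exp_truncation(2)[OF m] by (metis nrm_eq_0_iff)
  also have "\<dots> \<longleftrightarrow> z \<in> L"
    using poly_expo_eq_0_iff[OF finite_trunc zero_in_trunc] m by (auto simp: trunc_def)
  finally show ?thesis .
qed

lemma lattice_exp_add: "lattice_exp L (x + y) = lattice_exp L x + lattice_exp L y"
proof -
  have "(\<lambda>m. poly (expo (trunc L m)) (x + y)) \<longlonglongrightarrow> lattice_exp L x + lattice_exp L y"
    unfolding poly_expo_add[OF finite_trunc additive_subgroup_trunc]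
    by (intro na_tendsto_add lattice_exp_LIMSEQ)
  thus ?thesis using LIMSEQ_unique lattice_exp_LIMSEQ by blast
qed

lemma lattice_exp_diff: "lattice_exp L (x - y) = lattice_exp L x - lattice_exp L y"
  using lattice_exp_add[of "x - y" y] by simp

text \<open>Each factor 1 - z/l has norm max(1, |z/l|), as |z/l| = 1 is excluded. Large points z of
  this kind make 1/e(z) small.\<close>

lemma nrm_lattice_exp_ge:
  assumes "\<And>l. l \<in> L \<Longrightarrow> nrm l \<noteq> nrm z"
  shows "nrm (lattice_exp L z) \<ge> nrm z"
proof -
  obtain m where m: "real m > nrm z" using reals_Archimedean2 by blast
  have "nrm (1 - z / l) \<ge> 1" if "l \<in> trunc L m - {0}" for l
  proof (cases "nrm (z / l) < 1")
    case True
    thus ?thesis using nrm_add_eq[of "- (z / l)" 1] by simp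
  next
    case False
    moreover have "nrm (z / l) \<noteq> 1"
      using assms[of l] that by (auto simp: nrm_divide trunc_def)
    ultimately have "nrm (z / l) > 1" by linarith
    thus ?thesis using nrm_add_eq[of 1 "- (z / l)"] by simp
  qed
  hence "(\<Prod>l\<in>trunc L m - {0}. nrm (1 - z / l)) \<ge> 1" by (rule prod_ge_1)
  hence "nrm z * (\<Prod>l\<in>trunc L m - {0}. nrm (1 - z / l)) \<ge> nrm z * 1"
    by (intro mult_left_mono) auto
  thus ?thesis unfolding lattice_exp_truncation(2)[OF m] poly_expo nrm_mult nrm_prod by simp
qed

end

section \<open>Coefficients of truncated exponentials, and Goss polynomials of lattices\<close>

lemma nrm_coeff_mult_le:
  assumes "\<And>k. nrm (coeff p k) \<le> c" "\<And>k. nrm (coeff q k) \<le> d"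
  shows "nrm (coeff (p * q) k) \<le> c * d"
proof -
  have "0 \<le> c" "0 \<le> d" using assms nrm_ge_0 order.trans by blast+
  thus ?thesis
    unfolding coeff_mult using assms by (intro nrm_sum_le) (auto simp: nrm_mult intro!: mult_mono)
qed

text \<open>The analogue of \<open>prod_near_1\<close> for the Gauss norm, the largest norm of a
  coefficient.\<close>

lemma prod_linear_near_1:
  assumes "finite T" "\<And>l. l \<in> T \<Longrightarrow> nrm (inverse l) \<le> d" "0 \<le> d" "d \<le> 1"
  shows "(\<forall>k. nrm (coeff ((\<Prod>l\<in>T. [:1, - inverse l:]) - 1) k) \<le> d) \<and>
         (\<forall>k. nrm (coeff (\<Prod>l\<in>T. [:1, - inverse l:]) k) \<le> 1)"
  using assms
proof (induction T)
  case (insert a T)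
  define R where "R = (\<Prod>l\<in>T. [:1, - inverse l:])"
  have R: "nrm (coeff (R - 1) k) \<le> d" "nrm (coeff R k) \<le> 1" for k
    using insert unfolding R_def by auto
  have eq: "(\<Prod>l\<in>insert a T. [:1, - inverse l:]) = R + [:0, - inverse a:] * R"
    using insert by (simp add: R_def algebra_simps)
  have "nrm (coeff [:0, - inverse a:] k) \<le> d" for k
    using insert.prems by (auto simp: coeff_pCons split: nat.splits)
  hence aR: "nrm (coeff ([:0, - inverse a:] * R) k) \<le> d" for k
    using nrm_coeff_mult_le[of "[:0, - inverse a:]" d R 1 k] R by simp
  have "nrm (coeff (R - 1 + [:0, - inverse a:] * R) k) \<le> d" for k
    using nrm_ultra[of "coeff (R - 1) k" "coeff ([:0, - inverse a:] * R) k"] R(1)[of k] aR[of k]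
    unfolding coeff_add by linarith
  moreover have "nrm (coeff (R + [:0, - inverse a:] * R) k) \<le> 1" for k
    using nrm_ultra[of "coeff R k" "coeff ([:0, - inverse a:] * R) k"] R(2)[of k] aR[of k] insert.prems
    unfolding coeff_add by linarith
  moreover have "R + [:0, - inverse a:] * R - 1 = R - 1 + [:0, - inverse a:] * R" by simp
  ultimately show ?case unfolding eq by metis
qed auto

context
  fixes L :: "'c set"
  assumes L: "discrete_subgroup L"
begin

text \<open>Enlarging a ball of radius m multiplies the polynomial by a factor within 1/m of 1 in
  the Gauss norm. A uniform bound on the coefficients then makes each of them Cauchy.\<close>

lemma coeff_expo_trunc_convergent:
  obtains c where "(\<lambda>m. coeff (expo (trunc L m)) k) \<longlonglongrightarrow> c"
proof -
  define P where "P m = expo (trunc L m)" for m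
  define R where "R m n = (\<Prod>l\<in>trunc L n - trunc L m. [:1, - inverse l:])" for m n
  have split: "P n = P m * R m n" if "m \<le> n" for m n
  proof -
    have "(trunc L n - {0}) = (trunc L m - {0}) \<union> (trunc L n - trunc L m)"
      using trunc_mono[OF L that] zero_in_trunc[OF L, of m] by auto
    moreover have "(trunc L m - {0}) \<inter> (trunc L n - trunc L m) = {}" by auto
    ultimately show ?thesis
      unfolding P_def R_def expo_def using finite_trunc[OF L]
      by (simp only: prod.union_disjoint finite_Diff mult.assoc)
  qed
  have R: "(\<forall>k. nrm (coeff (R m n - 1) k) \<le> inverse m) \<and> (\<forall>k. nrm (coeff (R m n) k) \<le> 1)"
    if "m \<ge> 1" for m n
    unfolding R_def
  proof (rule prod_linear_near_1)
    fix l assume "l \<in> trunc L n - trunc L m"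
    hence "nrm l > real m" by (auto simp: trunc_def)
    thus "nrm (inverse l) \<le> inverse m" using that by (simp add: nrm_inverse le_imp_inverse_le)
  qed (use that finite_trunc[OF L] in \<open>auto simp: field_simps\<close>)
  \<comment> \<open>The ball of radius 1 already bounds all later coefficients: each further factor
    has |1/l| < 1 and does not increase the Gauss norm.\<close>
  define K where "K = Max ((\<lambda>k. nrm (coeff (P 1) k)) ` {..degree (P 1)})"
  have K0: "nrm (coeff (P 1) k) \<le> K" for k
  proof (cases "k \<le> degree (P 1)")
    case True
    thus ?thesis unfolding K_def by (intro Max_ge) auto
  next
    case False
    have "0 \<le> nrm (coeff (P 1) 0)" by simp
    also have "\<dots> \<le> K" unfolding K_def by (intro Max_ge) auto
    finally show ?thesis using False by (simp add: coeff_eq_0)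
  qed
  have Kpos: "K \<ge> 0" using K0[of 0] nrm_ge_0 order.trans by blast
  have K: "nrm (coeff (P m) k) \<le> K" if "m \<ge> 1" for m k
    using nrm_coeff_mult_le[of "P 1" K "R 1 m" 1 k] K0 R[of 1 m] split[OF that] by simp
  obtain c where "(\<lambda>m. coeff (P m) k) \<longlonglongrightarrow> c"
  proof (rule na_convergent)
    fix e :: real assume e: "e > 0"
    obtain m where m: "real m > K / e" "m \<ge> 1"
      by (metis reals_Archimedean2 max.cobounded1 max.cobounded2 of_nat_le_iff order.strict_trans2)
    have "nrm (coeff (P n) k - coeff (P m) k) < e" if "n \<ge> m" for n
    proof -
      have "P n - P m = P m * (R m n - 1)" by (simp add: split[OF that] algebra_simps)
      hence "nrm (coeff (P n) k - coeff (P m) k) \<le> K * inverse m"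
        using nrm_coeff_mult_le[of "P m" K "R m n - 1" "inverse m" k] K[OF m(2)] R[OF m(2)]
        by (metis coeff_diff)
      also have "\<dots> < e" using m e by (simp add: field_simps)
      finally show ?thesis .
    qed
    thus "\<exists>m. \<forall>n\<ge>m. nrm (coeff (P n) k - coeff (P m) k) < e" by blast
  qed
  thus thesis using that unfolding P_def by blast
qed

text \<open>All k are treated together because the induction on i convolves lower
  coefficients.\<close>

lemma coeff_expo_trunc_power_convergent:
  "\<exists>c. \<forall>k. (\<lambda>m. coeff (expo (trunc L m) ^ i) k) \<longlonglongrightarrow> c k"
proof (induction i)
  case 0
  show ?case by (intro exI[of _ "coeff 1"]) simp
next
  case (Suc i)
  then obtain c where c: "\<forall>k. (\<lambda>m. coeff (expo (trunc L m) ^ i) k) \<longlonglongrightarrow> c k" ..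
  have "\<exists>d. (\<lambda>m. coeff (expo (trunc L m)) k) \<longlonglongrightarrow> d" for k
    by (rule coeff_expo_trunc_convergent) (rule exI)
  then obtain d where d: "\<forall>k. (\<lambda>m. coeff (expo (trunc L m)) k) \<longlonglongrightarrow> d k" by metis
  have "(\<lambda>m. coeff (expo (trunc L m) ^ Suc i) k) \<longlonglongrightarrow> (\<Sum>l\<le>k. d l * c (k - l))" for k
    unfolding power_Suc coeff_mult by (intro na_tendsto_sum na_tendsto_mult c[rule_format] d[rule_format])
  thus ?case by (intro exI[of _ "\<lambda>k. \<Sum>l\<le>k. d l * c (k - l)"] allI)
qed

text \<open>Over an ultrametric field it is enough that the terms tend to 0 outside the balls. Both
  conclusions share the limit p, which links the sequence of balls to the unconditional sum.\<close>

lemma has_sum_lattice: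
  assumes j: "j > 0"
  obtains p where "(\<lambda>m. \<Sum>l\<in>trunc L m. inverse ((z + l) ^ j)) \<longlonglongrightarrow> p"
    "((\<lambda>l. inverse ((z + l) ^ j)) has_sum p) L"
proof -
  define f where "f l = inverse ((z + l) ^ j)" for l
  obtain p where "(\<lambda>m. sum f (trunc L m)) \<longlonglongrightarrow> p" "(sum f \<longlongrightarrow> p) (finite_subsets_at_top L)"
  proof (rule exhaustion_limit[of "trunc L" L "sum f"])
    fix e :: real assume e: "e > 0"
    obtain m where m: "real m > max (max 1 (nrm z)) (inverse e)" using reals_Archimedean2 by blast
    have "nrm (sum f S - sum f (trunc L m)) < e" if S: "finite S" "trunc L m \<subseteq> S" "S \<subseteq> L" for S
    proof -
      have "sum f S - sum f (trunc L m) = sum f (S - trunc L m)"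
        using S finite_trunc[OF L] by (simp add: sum_diff)
      also have "nrm \<dots> \<le> inverse m"
      proof (rule nrm_sum_le)
        fix l assume "l \<in> S - trunc L m"
        hence l: "nrm l > real m" using S by (auto simp: trunc_def)
        hence n: "nrm (z + l) = nrm l" using nrm_add_eq[of z l] m by (simp add: add.commute)
        have "real m \<le> nrm l ^ 1" using l by simp
        also have "\<dots> \<le> nrm l ^ j" using j l m by (intro power_increasing) auto
        finally show "nrm (f l) \<le> inverse m"
          using m by (simp add: f_def nrm_inverse nrm_power n)
      qed auto
      also have "inverse m < e" using m e by (simp add: field_simps)
      finally show ?thesis .
    qed
    thus "\<exists>m. \<forall>S. finite S \<and> trunc L m \<subseteq> S \<and> S \<subseteq> L \<longrightarrow> nrm (sum f S - sum f (trunc L m)) < e"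
      by auto
  qed (rule finite_trunc[OF L] trunc_subset[OF L] trunc_mono[OF L], assumption?)+
  hence "(\<lambda>m. sum f (trunc L m)) \<longlonglongrightarrow> p \<and> (f has_sum p) L" by (simp add: has_sum_def)
  thus thesis using that unfolding f_def by blast
qed

text \<open>Pass to the limit in the identity for balls: the number j of terms is fixed, the
  coefficients and e(z) converge, and e(z) is nonzero off the lattice. The vanishing constant term
  is recorded because it later makes G_n(u_a) vanish to high order.\<close>

lemma goss_poly_exists:
  assumes j: "j > 0"
  shows "\<exists>G. coeff G 0 = 0 \<and> lead_coeff G = 1 \<and> degree G = j \<and>
     (\<forall>z. z \<notin> L \<longrightarrow>
        ((\<lambda>l. inverse ((z + l) ^ j)) has_sum poly G (inverse (lattice_exp L z))) L)"
proof -
  have "\<exists>c. (\<lambda>m. coeff (expo (trunc L m) ^ i) (j - 1)) \<longlonglongrightarrow> c" for i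
    using coeff_expo_trunc_power_convergent[of i] by blast
  then obtain c where c: "\<And>i. (\<lambda>m. coeff (expo (trunc L m) ^ i) (j - 1)) \<longlonglongrightarrow> c i"
    by metis
  have "c (j - 1) = 1"
    using LIMSEQ_unique[OF tendsto_const c[of "j - 1", unfolded coeff_expo_power]] by simp
  hence G: "degree (goss_sum j c) = j" "lead_coeff (goss_sum j c) = 1"
    using degree_goss_sum j by blast+
  have "((\<lambda>l. inverse ((z + l) ^ j)) has_sum poly (goss_sum j c) (inverse (lattice_exp L z))) L"
    if z: "z \<notin> L" for z
  proof -
    obtain p where p: "(\<lambda>m. \<Sum>l\<in>trunc L m. inverse ((z + l) ^ j)) \<longlonglongrightarrow> p"
      "((\<lambda>l. inverse ((z + l) ^ j)) has_sum p) L"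
      using has_sum_lattice[OF j] by blast
    have nz: "lattice_exp L z \<noteq> 0" using z lattice_exp_eq_0_iff[OF L] by blast
    have "(\<Sum>l\<in>trunc L m. inverse ((z + l) ^ j))
        = (\<Sum>i<j. coeff (expo (trunc L m) ^ i) (j - 1) * inverse (poly (expo (trunc L m)) z) ^ Suc i)" for m
      using finite_goss_identity[OF finite_trunc[OF L] additive_subgroup_trunc[OF L] _ j] z trunc_subset[OF L]
      by (auto simp: poly_goss_sum)
    hence "(\<lambda>m. \<Sum>l\<in>trunc L m. inverse ((z + l) ^ j))
             \<longlonglongrightarrow> (\<Sum>i<j. c i * inverse (lattice_exp L z) ^ Suc i)"
      by (simp only: )
         (intro na_tendsto_sum na_tendsto_mult na_tendsto_power na_tendsto_inverse lattice_exp_LIMSEQ[OF L] c nz)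
    hence "p = poly (goss_sum j c) (inverse (lattice_exp L z))"
      using LIMSEQ_unique[OF p(1)] by (simp add: poly_goss_sum)
    thus ?thesis using p(2) by simp
  qed
  thus ?thesis using G by (intro exI[of _ "goss_sum j c"]) (auto simp: coeff_goss_sum)
qed

end

text \<open>All that is used about the set of values of u: it need not contain a punctured disc, but
  accumulation at 0 is enough to determine polynomials and power series.\<close>

definition accum_0 :: "'c set \<Rightarrow> bool" where
  "accum_0 U \<longleftrightarrow> (\<forall>r>0. \<exists>x\<in>U. 0 < nrm x \<and> nrm x < r)"

lemma accum_0_infinite:
  assumes "accum_0 U" "r > 0"
  shows "infinite {x \<in> U. 0 < nrm x \<and> nrm x < r}"
proof
  define V where "V = {x \<in> U. 0 < nrm x \<and> nrm x < r}"
  assume fin: "finite {x \<in> U. 0 < nrm x \<and> nrm x < r}"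
  hence fin: "finite V" by (simp add: V_def)
  have "V \<noteq> {}" using assms by (auto simp: accum_0_def V_def)
  hence "Min (nrm ` V) \<in> nrm ` V" using fin by (intro Min_in) auto
  hence pos: "Min (nrm ` V) > 0" by (auto simp: V_def)
  hence "min r (Min (nrm ` V)) > 0" using assms by simp
  then obtain x where x: "x \<in> U" "0 < nrm x" "nrm x < min r (Min (nrm ` V))"
    using assms unfolding accum_0_def by blast
  hence "x \<in> V" by (simp add: V_def)
  hence "Min (nrm ` V) \<le> nrm x" using fin by (intro Min_le) auto
  thus False using x by simp
qed

lemma poly_eqI_infinite:
  fixes p q :: "'c poly"
  assumes "infinite A" "\<And>x. x \<in> A \<Longrightarrow> poly p x = poly q x"
  shows "p = q"
proof (rule ccontr)
  assume "p \<noteq> q"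
  hence "finite {x. poly (p - q) x = 0}" by (intro poly_roots_finite) simp
  moreover have "A \<subseteq> {x. poly (p - q) x = 0}" using assms by auto
  ultimately show False using assms finite_subset by blast
qed

lemma na_has_sum_unique: "(f has_sum (a::'c)) A \<Longrightarrow> (f has_sum b) A \<Longrightarrow> a = b"
  using infsumI by blast

text \<open>Two such polynomials agree at infinitely many points 1/e(z). This is the uniqueness
  needed for the description in \<open>goss_poly\<close>.\<close>

lemma goss_poly_unique:
  fixes G H :: "'c poly"
  assumes acc: "accum_0 ((\<lambda>z. inverse (lattice_exp L z)) ` (- L))"
    and "\<And>z. z \<notin> L \<Longrightarrow> ((\<lambda>l. inverse ((z + l) ^ j)) has_sum poly G (inverse (lattice_exp L z))) L"
    and "\<And>z. z \<notin> L \<Longrightarrow> ((\<lambda>l. inverse ((z + l) ^ j)) has_sum poly H (inverse (lattice_exp L z))) L"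
  shows "G = H"
proof (rule poly_eqI_infinite)
  show "infinite {x \<in> (\<lambda>z. inverse (lattice_exp L z)) ` (- L). 0 < nrm x \<and> nrm x < 1}"
    by (rule accum_0_infinite[OF acc]) simp
  fix x assume "x \<in> {x \<in> (\<lambda>z. inverse (lattice_exp L z)) ` (- L). 0 < nrm x \<and> nrm x < 1}"
  then obtain z where "z \<notin> L" "x = inverse (lattice_exp L z)" by auto
  thus "poly G x = poly H x" using assms(2,3) na_has_sum_unique by blast
qed

lemma goss_poly_correct:
  assumes "discrete_subgroup L" "accum_0 ((\<lambda>z. inverse (lattice_exp L z)) ` (- L))" "j > 0"
  shows "coeff (goss_poly j L) 0 = 0" "lead_coeff (goss_poly j L) = 1" "degree (goss_poly j L) = j"
    "z \<notin> L \<Longrightarrow> ((\<lambda>l. inverse ((z + l) ^ j)) has_sum poly (goss_poly j L) (inverse (lattice_exp L z))) L"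
proof -
  obtain G where G: "coeff G 0 = 0" "lead_coeff G = 1" "degree G = j"
     "\<And>z. z \<notin> L \<Longrightarrow>
        ((\<lambda>l. inverse ((z + l) ^ j)) has_sum poly G (inverse (lattice_exp L z))) L"
    using goss_poly_exists[OF assms(1,3)] by blast
  have "goss_poly j L = G"
    unfolding goss_poly_def
    by (rule the_equality) (use G goss_poly_unique[OF assms(2), of j] in blast)+
  thus "coeff (goss_poly j L) 0 = 0" "lead_coeff (goss_poly j L) = 1" "degree (goss_poly j L) = j"
    "z \<notin> L \<Longrightarrow> ((\<lambda>l. inverse ((z + l) ^ j)) has_sum poly (goss_poly j L) (inverse (lattice_exp L z))) L"
    using G by auto
qed

lemma lattice_exp_finite:
  assumes "finite S" "additive_subgroup S"
  shows "lattice_exp S z = poly (expo S) z"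
proof -
  have "finite_subsets_at_top (S - {0}) = principal {S - {0}}"
    using assms by (simp add: finite_subsets_at_top_finite)
  hence "((\<lambda>T. \<Prod>l\<in>T. 1 - z / l) \<longlongrightarrow> (\<Prod>l\<in>S - {0}. 1 - z / l)) (finite_subsets_at_top (S - {0}))"
    by (simp add: tendsto_principal_singleton)
  from tendsto_Lim[OF finite_subsets_at_top_neq_bot this]
  show ?thesis by (simp add: lattice_exp_def poly_expo)
qed

text \<open>For a finite subgroup the coefficients stay explicit; they are needed to see which
  powers of u occur in the Goss polynomials of the torsion.\<close>

lemma goss_poly_finite:
  assumes S: "finite S" "additive_subgroup S" and j: "j > 0"
    and acc: "accum_0 ((\<lambda>z. inverse (lattice_exp S z)) ` (- S))"
  shows "goss_poly j S = goss_sum j (\<lambda>i. coeff (expo S ^ i) (j - 1))"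
proof (rule goss_poly_unique[OF acc, of j])
  have "discrete_subgroup S" using S by (simp add: discrete_subgroup_def)
  from goss_poly_correct(4)[OF this acc j]
  show "((\<lambda>l. inverse ((z + l) ^ j)) has_sum poly (goss_poly j S) (inverse (lattice_exp S z))) S"
    if "z \<notin> S" for z using that .
  fix z assume z: "z \<notin> S"
  show "((\<lambda>l. inverse ((z + l) ^ j)) has_sum
      poly (goss_sum j (\<lambda>i. coeff (expo S ^ i) (j - 1))) (inverse (lattice_exp S z))) S"
    unfolding lattice_exp_finite[OF S] finite_goss_identity[OF S z j, symmetric]
    using S by (intro has_sum_finite)
qed

end

section \<open>Power series and the functions they represent\<close>

text \<open>The expansion of \<open>1/p(1/X)\<close>, so that composition of polynomials becomes composition of series.\<close>

definition recip_fps :: "'a::field poly \<Rightarrow> 'a fps" where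
  "recip_fps p = fps_X ^ degree p * inverse (fps_of_poly (reflect_poly p))"

lemma fps_of_poly_compose:
  fixes P :: "'a::idom poly"
  assumes "b $ 0 = 0"
  shows "fps_of_poly P oo b = poly (map_poly fps_const P) b"
  by (induction P)
     (simp_all add: fps_of_poly_pCons map_poly_pCons fps_compose_add_distrib
        fps_compose_mult_distrib[OF assms] fps_X_fps_compose_startby0[OF assms])

lemma poly_fps_const_compose:
  fixes F :: "'a::idom fps"
  assumes "b $ 0 = 0"
  shows "poly (map_poly fps_const P) F oo b = poly (map_poly fps_const P) (F oo b)"
  by (induction P)
     (simp_all add: map_poly_pCons fps_compose_add_distrib fps_compose_mult_distrib[OF assms])

lemma recip_fps_compose:
  fixes p :: "'a::field poly"
  assumes "b $ 0 = 0" "p \<noteq> 0"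
  shows "recip_fps p oo b = b ^ degree p * inverse (poly (map_poly fps_const (reflect_poly p)) b)"
  using assms fps_X_power_compose[of b "degree p"]
  by (simp add: recip_fps_def fps_compose_mult_distrib fps_inverse_compose fps_of_poly_compose)

lemma recip_fps_nth_0:
  assumes "degree p > 0"
  shows "recip_fps p $ 0 = 0"
  using assms by (simp add: recip_fps_def)

lemma recip_fps_nth_eq_0:
  assumes "k < degree p"
  shows "recip_fps p $ k = 0"
  using assms by (simp add: recip_fps_def fps_X_power_mult_nth)

lemma recip_fps_nonzero:
  fixes p :: "'a::field poly"
  assumes "p \<noteq> 0"
  shows "recip_fps p \<noteq> 0"
  using assms by (auto simp: recip_fps_def)

context nonarch_field
begin

text \<open>Only nonzero points of U are tested, as in \<open>u_expansion\<close>: the functions of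
  interest involve \<open>inverse x\<close>, whose value at 0 is a mere convention.\<close>

definition represents :: "'c set \<Rightarrow> 'c fps \<Rightarrow> ('c \<Rightarrow> 'c) \<Rightarrow> bool" where
  "represents U F f \<longleftrightarrow>
     (\<exists>r>0. \<forall>x\<in>U. 0 < nrm x \<and> nrm x < r \<longrightarrow> (\<lambda>j. fps_nth F j * x ^ j) sums f x)"

lemma represents_cong:
  assumes "represents U F f" "\<exists>r>0. \<forall>x\<in>U. 0 < nrm x \<and> nrm x < r \<longrightarrow> f x = g x"
  shows "represents U F g"
proof -
  obtain r s where "r > 0" "s > 0"
    "\<forall>x\<in>U. 0 < nrm x \<and> nrm x < r \<longrightarrow> (\<lambda>j. fps_nth F j * x ^ j) sums f x"
    "\<forall>x\<in>U. 0 < nrm x \<and> nrm x < s \<longrightarrow> f x = g x"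
    using assms unfolding represents_def by blast
  thus ?thesis unfolding represents_def by (intro exI[of _ "min r s"]) auto
qed

section \<open>Ultrametric series with geometrically bounded terms\<close>

lemma na_sums_zero:
  assumes "(f :: nat \<Rightarrow> 'c) sums s"
  shows "f \<longlonglongrightarrow> 0"
proof -
  have "(\<lambda>n. sum f {..<Suc n} + (-1) * sum f {..<n}) \<longlonglongrightarrow> s + (-1) * s"
    using assms unfolding sums_def
    by (intro na_tendsto_add na_tendsto_mult tendsto_const LIMSEQ_Suc[where f = "\<lambda>n. sum f {..<n}"])
  thus ?thesis by simp
qed

lemma na_geometric_bound_pos:
  assumes "\<And>n. nrm (a n) \<le> C * \<rho> ^ n"
  shows "0 \<le> C"
  using assms[of 0] nrm_ge_0[of "a 0"] by (metis mult.right_neutral order.trans power_0)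

lemma nrm_geometric_tail:
  assumes a: "\<And>n. nrm (a n) \<le> C * \<rho> ^ n" and \<rho>: "0 \<le> \<rho>" "\<rho> < 1"
    and A: "\<And>n. n \<in> A \<Longrightarrow> m \<le> n"
  shows "nrm (sum a A) \<le> C * \<rho> ^ m"
proof (rule nrm_sum_le)
  note C = na_geometric_bound_pos[OF a]
  fix n assume "n \<in> A"
  hence "\<rho> ^ n \<le> \<rho> ^ m" using A \<rho> by (intro power_decreasing) auto
  thus "nrm (a n) \<le> C * \<rho> ^ m" using a[of n] mult_left_mono[OF _ C] by fastforce
qed (use na_geometric_bound_pos[OF a] \<rho> in auto)

lemma geometric_eventually_small:
  assumes "0 \<le> \<rho>" "\<rho> < (1::real)" "e > 0"
  shows "\<exists>m. C * \<rho> ^ m < e"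
proof -
  have "(\<lambda>m. C * \<rho> ^ m) \<longlonglongrightarrow> C * 0"
    using assms by (intro tendsto_intros LIMSEQ_power_zero) auto
  hence "\<forall>\<^sub>F m in sequentially. C * \<rho> ^ m < e" using assms(3) by (intro order_tendstoD(2)) auto
  thus ?thesis by (auto simp: eventually_sequentially)
qed

lemma geometric_bound_sums:
  assumes a: "\<And>n. nrm (a n) \<le> C * \<rho> ^ n" and \<rho>: "0 \<le> \<rho>" "\<rho> < 1"
  obtains s where "a sums s"
proof -
  obtain s where "(\<lambda>n. sum a {..<n}) \<longlonglongrightarrow> s"
  proof (rule na_convergent)
    fix e :: real assume "e > 0"
    then obtain m where m: "C * \<rho> ^ m < e" using geometric_eventually_small \<rho> by blast
    have "nrm (sum a {..<n} - sum a {..<m}) < e" if "n \<ge> m" for n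
    proof -
      have "sum a {..<n} - sum a {..<m} = sum a ({..<n} - {..<m})"
        using that by (subst sum_diff) auto
      also have "nrm \<dots> \<le> C * \<rho> ^ m" using a \<rho> by (intro nrm_geometric_tail) auto
      finally show ?thesis using m by simp
    qed
    thus "\<exists>m. \<forall>n\<ge>m. nrm (sum a {..<n} - sum a {..<m}) < e" by blast
  qed
  thus thesis using that unfolding sums_def by blast
qed

text \<open>The product of the partial sums differs from the partial Cauchy sum by the pairs i, j <
  n with i + j \<ge> n, and each such term has norm at most C D \<rho>^n.\<close>

lemma na_Cauchy_product_sums:
  assumes a: "\<And>n. nrm (a n) \<le> C * \<rho> ^ n" "a sums A"
    and b: "\<And>n. nrm (b n) \<le> D * \<rho> ^ n" "b sums B"
    and \<rho>: "0 \<le> \<rho>" "\<rho> < 1"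
  shows "(\<lambda>n. \<Sum>i\<le>n. a i * b (n - i)) sums (A * B)"
proof -
  have C: "0 \<le> C" and D: "0 \<le> D" using a b na_geometric_bound_pos by blast+
  have diff: "nrm ((\<Sum>k<n. \<Sum>i\<le>k. a i * b (k - i)) - sum a {..<n} * sum b {..<n}) \<le> C * D * \<rho> ^ n"
    for n
  proof -
    define S where "S = {..<n} \<times> {..<n}"
    define T where "T = {(i, j). i + j < n}"
    have T: "T \<subseteq> S" by (auto simp: S_def T_def)
    have "(\<Sum>k<n. \<Sum>i\<le>k. a i * b (k - i)) = (\<Sum>(i,j)\<in>T. a i * b j)"
      unfolding T_def by (rule sum.triangle_reindex[symmetric])
    moreover have "sum a {..<n} * sum b {..<n} = (\<Sum>(i,j)\<in>S. a i * b j)"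
      unfolding S_def by (simp add: sum_product sum.cartesian_product)
    moreover have "(\<Sum>(i,j)\<in>S - T. a i * b j) = (\<Sum>(i,j)\<in>S. a i * b j) - (\<Sum>(i,j)\<in>T. a i * b j)"
      using T by (intro sum_diff) (auto simp: S_def)
    ultimately have "nrm ((\<Sum>k<n. \<Sum>i\<le>k. a i * b (k - i)) - sum a {..<n} * sum b {..<n})
        = nrm (\<Sum>(i,j)\<in>S - T. a i * b j)"
      by (simp add: nrm_minus_commute)
    also have "\<dots> \<le> C * D * \<rho> ^ n"
    proof (rule nrm_sum_le)
      fix x assume "x \<in> S - T"
      then obtain i j where x: "x = (i, j)" "n \<le> i + j" by (cases x) (auto simp: T_def S_def)
      have "nrm (a i * b j) \<le> (C * \<rho> ^ i) * (D * \<rho> ^ j)"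
        unfolding nrm_mult using a(1)[of i] b(1)[of j] C \<rho> by (intro mult_mono) auto
      also have "\<dots> = C * D * \<rho> ^ (i + j)" by (simp add: power_add)
      also have "\<dots> \<le> C * D * \<rho> ^ n"
        using x C D \<rho> by (intro mult_left_mono power_decreasing) auto
      finally show "nrm (case x of (i, j) \<Rightarrow> a i * b j) \<le> C * D * \<rho> ^ n" using x by simp
    qed (use C D \<rho> in auto)
    finally show ?thesis .
  qed
  have "(\<lambda>n. (\<Sum>k<n. \<Sum>i\<le>k. a i * b (k - i)) - sum a {..<n} * sum b {..<n}) \<longlonglongrightarrow> 0"
    unfolding tendsto_nrm_iff
  proof (rule tendsto_sandwich[where f = "\<lambda>_. 0" and h = "\<lambda>n. C * D * \<rho> ^ n"])
    have "(\<lambda>n. C * D * \<rho> ^ n) \<longlonglongrightarrow> C * D * 0"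
      using \<rho> by (intro tendsto_intros LIMSEQ_power_zero) auto
    thus "(\<lambda>n. C * D * \<rho> ^ n) \<longlonglongrightarrow> 0" by simp
  qed (use diff in auto)
  moreover have "(\<lambda>n. sum a {..<n} * sum b {..<n}) \<longlonglongrightarrow> A * B"
    using a(2) b(2) unfolding sums_def by (rule na_tendsto_mult)
  ultimately have "(\<lambda>n. ((\<Sum>k<n. \<Sum>i\<le>k. a i * b (k - i)) - sum a {..<n} * sum b {..<n})
      + sum a {..<n} * sum b {..<n}) \<longlonglongrightarrow> 0 + A * B"
    by (rule na_tendsto_add)
  thus ?thesis by (simp add: sums_def)
qed

context
  fixes U :: "'c set"
  assumes U: "accum_0 U"
begin

text \<open>Convergence at a single nonzero point x of U bounds the terms there, hence the
  coefficients by K |x|^(-j).\<close>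

lemma represents_bound:
  assumes "represents U F f"
  obtains C R where "C > 0" "R > 0" "\<And>j. nrm (F $ j) \<le> C * R ^ j"
proof -
  obtain r where r: "r > 0"
    "\<And>x. x \<in> U \<Longrightarrow> 0 < nrm x \<Longrightarrow> nrm x < r \<Longrightarrow> (\<lambda>j. F $ j * x ^ j) sums f x"
    using assms unfolding represents_def by blast
  obtain x where x: "x \<in> U" "0 < nrm x" "nrm x < r" using U r(1) unfolding accum_0_def by blast
  have "(\<lambda>j. nrm (F $ j * x ^ j)) \<longlonglongrightarrow> nrm 0"
    by (intro tendsto_nrm na_sums_zero[OF r(2)] x)
  hence "Bseq (\<lambda>j. nrm (F $ j * x ^ j))" by (intro convergent_imp_Bseq) (auto simp: convergent_def)
  then obtain K where K: "K > 0" "\<And>j. norm (nrm (F $ j * x ^ j)) \<le> K" by (auto elim: BseqE)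
  have "nrm (F $ j) \<le> K * inverse (nrm x) ^ j" for j
  proof -
    have "nrm (F $ j) * nrm x ^ j \<le> K" using K(2)[of j] by (simp add: nrm_mult nrm_power)
    thus ?thesis using x by (simp add: field_simps power_inverse)
  qed
  thus thesis using that K(1) x by (metis inverse_positive_iff_positive)
qed

lemma represents_const: "represents U (fps_const c) (\<lambda>_. c)"
proof -
  have "(\<lambda>j. fps_const c $ j * x ^ j) sums c" for x
    using sums_If_finite_set[of "{0}" "\<lambda>_. c"]
    unfolding sums_def
    by (intro tendsto_eventually) (auto simp: eventually_sequentially sum.remove[of _ 0] intro!: exI[of _ 1])
  thus ?thesis unfolding represents_def by (intro exI[of _ 1]) simp
qed

lemma represents_X: "represents U fps_X (\<lambda>x. x)"
proof -
  have "(\<lambda>j. fps_X $ j * x ^ j) sums x" for x :: 'c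
    unfolding sums_def
    by (intro tendsto_eventually) (auto simp: eventually_sequentially sum.remove[of _ 1] intro!: exI[of _ 2])
  thus ?thesis unfolding represents_def by (intro exI[of _ 1]) simp
qed

lemma represents_add:
  assumes "represents U F f" "represents U G g"
  shows "represents U (F + G) (\<lambda>x. f x + g x)"
proof -
  obtain r s where rs: "r > 0" "s > 0"
    "\<forall>x\<in>U. 0 < nrm x \<and> nrm x < r \<longrightarrow> (\<lambda>j. F $ j * x ^ j) sums f x"
    "\<forall>x\<in>U. 0 < nrm x \<and> nrm x < s \<longrightarrow> (\<lambda>j. G $ j * x ^ j) sums g x"
    using assms unfolding represents_def by blast
  have "(\<lambda>j. (F + G) $ j * x ^ j) sums (f x + g x)" if "x \<in> U" "0 < nrm x" "nrm x < min r s" for x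
  proof -
    have "(\<lambda>j. F $ j * x ^ j) sums f x" "(\<lambda>j. G $ j * x ^ j) sums g x" using rs that by auto
    thus ?thesis
      unfolding sums_def using na_tendsto_add by (fastforce simp: algebra_simps sum.distrib)
  qed
  thus ?thesis using rs unfolding represents_def by (intro exI[of _ "min r s"]) auto
qed

text \<open>One radius r and one rate R for both series; r R \<le> 1 keeps the ratio |x| R below 1,
  as the Cauchy product requires.\<close>

lemma represents_sums:
  assumes "represents U F f" "represents U G g"
  obtains C D R r where "0 < R" "0 < r" "r * R \<le> 1"
    "\<And>x. x \<in> U \<Longrightarrow> 0 < nrm x \<Longrightarrow> nrm x < r \<Longrightarrow>
      (\<lambda>j. F $ j * x ^ j) sums f x \<and> (\<lambda>j. G $ j * x ^ j) sums g x"
    "\<And>x j. nrm (F $ j * x ^ j) \<le> C * (nrm x * R) ^ j"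
    "\<And>x j. nrm (G $ j * x ^ j) \<le> D * (nrm x * R) ^ j"
proof -
  obtain r s where rs: "r > 0" "s > 0"
    "\<forall>x\<in>U. 0 < nrm x \<and> nrm x < r \<longrightarrow> (\<lambda>j. F $ j * x ^ j) sums f x"
    "\<forall>x\<in>U. 0 < nrm x \<and> nrm x < s \<longrightarrow> (\<lambda>j. G $ j * x ^ j) sums g x"
    using assms unfolding represents_def by blast
  obtain C R where CR: "C > 0" "R > 0" "\<And>j. nrm (F $ j) \<le> C * R ^ j"
    using represents_bound[OF assms(1)] by blast
  obtain D S where DS: "D > 0" "S > 0" "\<And>j. nrm (G $ j) \<le> D * S ^ j"
    using represents_bound[OF assms(2)] by blast
  define M where "M = max R S"
  define t where "t = min (min r s) (inverse M)"
  have M: "M > 0" "R \<le> M" "S \<le> M" using CR DS by (auto simp: M_def)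
  have bound: "nrm (c * x ^ j) \<le> K * (nrm x * M) ^ j"
    if "nrm c \<le> K * Q ^ j" "0 < K" "0 < Q" "Q \<le> M" for c x K Q j
  proof -
    have "K * Q ^ j \<le> K * M ^ j" using that by (intro mult_left_mono power_mono) auto
    hence "nrm c \<le> K * M ^ j" using that(1) by (rule order.trans[rotated])
    hence "nrm c * nrm x ^ j \<le> K * M ^ j * nrm x ^ j" by (rule mult_right_mono) simp
    thus ?thesis by (simp add: nrm_mult nrm_power power_mult_distrib mult_ac)
  qed
  have "t * M \<le> inverse M * M" unfolding t_def using M by (intro mult_right_mono) auto
  hence "t * M \<le> 1" using M by simp
  moreover have "t > 0" using rs M by (simp add: t_def)
  moreover have "(\<lambda>j. F $ j * x ^ j) sums f x \<and> (\<lambda>j. G $ j * x ^ j) sums g x"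
    if "x \<in> U" "0 < nrm x" "nrm x < t" for x using rs that by (auto simp: t_def)
  moreover have "nrm (F $ j * x ^ j) \<le> C * (nrm x * M) ^ j" for x j
    using bound[OF CR(3)] CR M by blast
  moreover have "nrm (G $ j * x ^ j) \<le> D * (nrm x * M) ^ j" for x j
    using bound[OF DS(3)] DS M by blast
  ultimately show thesis using that M(1) by blast
qed

lemma represents_mult:
  assumes "represents U F f" "represents U G g"
  shows "represents U (F * G) (\<lambda>x. f x * g x)"
proof -
  obtain C D R r where R: "0 < R" "0 < r" "r * R \<le> 1"
    "\<And>x. x \<in> U \<Longrightarrow> 0 < nrm x \<Longrightarrow> nrm x < r \<Longrightarrow>
      (\<lambda>j. F $ j * x ^ j) sums f x \<and> (\<lambda>j. G $ j * x ^ j) sums g x"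
    "\<And>x j. nrm (F $ j * x ^ j) \<le> C * (nrm x * R) ^ j"
    "\<And>x j. nrm (G $ j * x ^ j) \<le> D * (nrm x * R) ^ j"
    by (rule represents_sums[OF assms]) (rule that)
  have "(\<lambda>j. (F * G) $ j * x ^ j) sums (f x * g x)" if x: "x \<in> U" "0 < nrm x" "nrm x < r" for x
  proof -
    have "nrm x * R < r * R" using x R by (intro mult_strict_right_mono) auto
    hence "nrm x * R < 1" using R by linarith
    hence "(\<lambda>n. \<Sum>i\<le>n. (F $ i * x ^ i) * (G $ (n - i) * x ^ (n - i))) sums (f x * g x)"
      using R(4)[OF x] R(1) by (intro na_Cauchy_product_sums[OF R(5) _ R(6)]) auto
    moreover have "(\<Sum>i\<le>n. (F $ i * x ^ i) * (G $ (n - i) * x ^ (n - i))) = (F * G) $ n * x ^ n" for n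
    proof -
      have "(F $ i * x ^ i) * (G $ (n - i) * x ^ (n - i)) = F $ i * G $ (n - i) * x ^ n" if "i \<le> n" for i
        using that power_add[of x i "n - i"] by (simp add: mult_ac)
      thus ?thesis
        unfolding fps_mult_nth sum_distrib_right atMost_atLeast0 by (intro sum.cong) auto
    qed
    ultimately show ?thesis by simp
  qed
  thus ?thesis using R unfolding represents_def by (intro exI[of _ r]) auto
qed

lemma represents_power:
  assumes "represents U F f"
  shows "represents U (F ^ n) (\<lambda>x. f x ^ n)"
proof (induction n)
  case 0
  thus ?case using represents_const[of 1] by simp
next
  case (Suc n)
  thus ?case using represents_mult[OF assms Suc] by simp
qed

lemma represents_sum:
  assumes "\<And>i. i \<in> I \<Longrightarrow> represents U (F i) (f i)"
  shows "represents U (\<Sum>i\<in>I. F i) (\<lambda>x. \<Sum>i\<in>I. f i x)"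
  using assms
proof (induction I rule: infinite_finite_induct)
  case (insert i I)
  thus ?case using represents_add[of "F i" "f i" "\<Sum>i\<in>I. F i" "\<lambda>x. \<Sum>i\<in>I. f i x"] by simp
qed (use represents_const[of 0] in auto)

lemma represents_poly:
  assumes "represents U F f"
  shows "represents U (poly (map_poly fps_const p) F) (\<lambda>x. poly p (f x))"
proof (induction p)
  case 0
  thus ?case using represents_const[of 0] by simp
next
  case (pCons a p)
  thus ?case
    using represents_add[OF represents_const[of a] represents_mult[OF assms pCons.IH]]
    by (simp add: map_poly_pCons)
qed

text \<open>Near 0 the lowest nonzero term of the difference dominates all others, so the norm of
  its partial sums is eventually constant and positive, whereas the sum is 0.\<close>

lemma represents_unique:
  assumes F: "represents U F f" and G: "represents U G g"
    and eq: "\<exists>r>0. \<forall>x\<in>U. 0 < nrm x \<and> nrm x < r \<longrightarrow> f x = g x"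
  shows "F = G"
proof (rule ccontr)
  assume "F \<noteq> G"
  define H where "H = F + fps_const (-1) * G"
  have "fps_const (-1) = (-1 :: 'c fps)" by (metis fps_const_1_eq_1 fps_const_neg)
  hence "H = F - G" by (simp only: H_def mult_minus1 diff_conv_add_uminus)
  hence nz: "H \<noteq> 0" using \<open>F \<noteq> G\<close> by simp
  define m where "m = subdegree H"
  have Hm: "H $ m \<noteq> 0" unfolding m_def using nz by (rule nth_subdegree_nonzero)
  have H_low: "H $ j = 0" if "j < m" for j using that unfolding m_def by (rule nth_less_subdegree_zero)
  have H: "represents U H (\<lambda>x. f x + (-1) * g x)"
    unfolding H_def by (intro represents_add represents_mult represents_const F G)
  obtain r where r: "r > 0" "\<And>x. x \<in> U \<Longrightarrow> 0 < nrm x \<Longrightarrow> nrm x < r \<Longrightarrow> f x = g x" using eq by blast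
  have "represents U H (\<lambda>_. 0)"
    using H by (rule represents_cong) (use r in auto)
  then obtain s where s: "s > 0" "\<And>x. x \<in> U \<Longrightarrow> 0 < nrm x \<Longrightarrow> nrm x < s \<Longrightarrow> (\<lambda>j. H $ j * x ^ j) sums 0"
    unfolding represents_def by blast
  obtain C R where CR: "C > 0" "R > 0" "\<And>j. nrm (H $ j) \<le> C * R ^ j"
    using represents_bound[OF H] by blast
  \<comment> \<open>Below s the series sums to 0, below 1/R the tail is geometric, and below the
    last bound the tail from m + 1 on is smaller than the term of index m.\<close>
  define t where "t = min s (min (inverse R) (nrm (H $ m) / (C * R ^ Suc m)))"
  have "t > 0" using s CR Hm by (simp add: t_def)
  then obtain x where x: "x \<in> U" "0 < nrm x" "nrm x < t" using U unfolding accum_0_def by blast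
  have "nrm x < inverse R" using x by (simp add: t_def)
  hence "nrm x * R < inverse R * R" using CR by (intro mult_strict_right_mono) auto
  hence xR: "nrm x * R < 1" using CR by simp
  have small: "C * (nrm x * R) ^ Suc m < nrm (H $ m) * nrm x ^ m"
  proof -
    have "nrm x * (C * R ^ Suc m) < nrm (H $ m)"
      using x CR by (simp add: t_def field_simps)
    hence "nrm x * (C * R ^ Suc m) * nrm x ^ m < nrm (H $ m) * nrm x ^ m"
      using x by (intro mult_strict_right_mono) auto
    thus ?thesis by (simp add: power_mult_distrib mult_ac)
  qed
  have bd: "nrm (H $ j * x ^ j) \<le> C * (nrm x * R) ^ j" for j
    using mult_right_mono[OF CR(3)[of j], of "nrm x ^ j"]
    by (simp add: nrm_mult nrm_power power_mult_distrib mult_ac)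
  have "nrm (\<Sum>j<n. H $ j * x ^ j) = nrm (H $ m) * nrm x ^ m" if "n > m" for n
  proof -
    have "(\<Sum>j<n. H $ j * x ^ j) = (\<Sum>j\<in>{m..<n}. H $ j * x ^ j)"
      using H_low by (intro sum.mono_neutral_right) auto
    also have "\<dots> = H $ m * x ^ m + (\<Sum>j\<in>{Suc m..<n}. H $ j * x ^ j)"
      using that by (rule sum.atLeast_Suc_lessThan)
    also have "nrm \<dots> = nrm (H $ m * x ^ m)"
    proof (rule nrm_add_eq)
      have "nrm (\<Sum>j\<in>{Suc m..<n}. H $ j * x ^ j) \<le> C * (nrm x * R) ^ Suc m"
        using bd xR CR by (intro nrm_geometric_tail) auto
      also note small
      finally show "nrm (\<Sum>j\<in>{Suc m..<n}. H $ j * x ^ j) < nrm (H $ m * x ^ m)"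
        by (simp add: nrm_mult nrm_power)
    qed
    finally show ?thesis by (simp add: nrm_mult nrm_power)
  qed
  hence "(\<lambda>n. nrm (\<Sum>j<n. H $ j * x ^ j)) \<longlonglongrightarrow> nrm (H $ m) * nrm x ^ m"
    by (intro tendsto_eventually) (auto simp: eventually_sequentially intro!: exI[of _ "Suc m"])
  moreover have "(\<lambda>n. nrm (\<Sum>j<n. H $ j * x ^ j)) \<longlonglongrightarrow> nrm 0"
    using s(2)[of x] x unfolding sums_def t_def by (intro tendsto_nrm) auto
  ultimately have "nrm (H $ m) * nrm x ^ m = nrm 0" using LIMSEQ_unique by blast
  thus False using Hm x by simp
qed

text \<open>Induction on the recursion expressing a coefficient of the inverse by earlier ones. The
  rate S is at least R and C R / |F_0|, so that (C / |F_0|) R^k \<le> S^k for all k \<ge> 1.\<close>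

lemma nrm_inverse_fps_nth_le:
  fixes F :: "'c fps"
  assumes F0: "F $ 0 \<noteq> 0" and CR: "C > 0" "R > 0" "\<And>j. nrm (F $ j) \<le> C * R ^ j"
  defines "S \<equiv> R * max 1 (C / nrm (F $ 0))"
  shows "nrm (inverse F $ n) \<le> inverse (nrm (F $ 0)) * S ^ n"
proof (induction n rule: less_induct)
  case (less n)
  define a where "a = nrm (F $ 0)"
  have a: "a > 0" using F0 by (simp add: a_def)
  have "R * 1 \<le> S" "R * (C / a) \<le> S"
    unfolding S_def a_def[symmetric] using CR by (intro mult_left_mono; simp)+
  hence S: "S > 0" "R \<le> S" "C / a * R \<le> S"
    using CR by (auto simp: mult.commute)
  show ?case
  proof (cases "n = 0")
    case True
    thus ?thesis using F0 by (simp add: nrm_inverse)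
  next
    case False
    have "(F * inverse F) $ n = 0" using inverse_mult_eq_1'[OF F0] False by simp
    hence "0 = (\<Sum>k=0..n. F $ k * inverse F $ (n - k))" by (simp add: fps_mult_nth)
    also have "\<dots> = F $ 0 * inverse F $ n + (\<Sum>k=Suc 0..n. F $ k * inverse F $ (n - k))"
      by (subst sum.atLeast_Suc_atMost) auto
    finally have "F $ 0 * inverse F $ n = - (\<Sum>k=Suc 0..n. F $ k * inverse F $ (n - k))"
      by (simp add: eq_neg_iff_add_eq_0)
    hence "a * nrm (inverse F $ n) = nrm (\<Sum>k=Suc 0..n. F $ k * inverse F $ (n - k))"
      unfolding a_def by (metis nrm_minus nrm_mult)
    also have "\<dots> \<le> S ^ n"
    proof (rule nrm_sum_le)
      fix k assume k: "k \<in> {Suc 0..n}"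
      have "C / a * R ^ k = C / a * R * R ^ (k - 1)" using k by (cases k) auto
      also have "\<dots> \<le> S * S ^ (k - 1)"
        using S CR a by (intro mult_mono power_mono) auto
      also have "\<dots> = S ^ k" using k by (cases k) auto
      finally have Sk: "C / a * R ^ k \<le> S ^ k" .
      have "nrm (F $ k * inverse F $ (n - k)) \<le> (C * R ^ k) * (inverse a * S ^ (n - k))"
        unfolding nrm_mult a_def using k CR less.IH[of "n - k"] by (intro mult_mono) auto
      also have "\<dots> = C / a * R ^ k * S ^ (n - k)" by (simp add: field_simps)
      also have "\<dots> \<le> S ^ k * S ^ (n - k)" using Sk S by (intro mult_right_mono) auto
      also have "\<dots> = S ^ n" using k by (simp flip: power_add)
      finally show "nrm (F $ k * inverse F $ (n - k)) \<le> S ^ n" .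
    qed (use S in auto)
    finally show ?thesis using a by (simp add: field_simps a_def)
  qed
qed

text \<open>The coefficient bound gives the inverse series some limit function h near 0; the Cauchy
  product f h = 1 identifies it.\<close>

lemma represents_inverse:
  assumes F: "represents U F f" and F0: "F $ 0 \<noteq> 0"
  shows "represents U (inverse F) (\<lambda>x. inverse (f x))"
proof -
  obtain C R where CR: "C > 0" "R > 0" "\<And>j. nrm (F $ j) \<le> C * R ^ j"
    using represents_bound[OF F] by blast
  define D where "D = inverse (nrm (F $ 0))"
  define S where "S = R * max 1 (C / nrm (F $ 0))"
  have S: "S > 0" using CR by (simp add: S_def)
  have "\<exists>s. (\<lambda>j. inverse F $ j * x ^ j) sums s" if x: "nrm x < inverse S" for x
  proof -
    have b: "nrm (inverse F $ j * x ^ j) \<le> D * (nrm x * S) ^ j" for j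
      using mult_right_mono[OF nrm_inverse_fps_nth_le[OF F0 CR, of j], of "nrm x ^ j"]
      by (simp add: nrm_mult nrm_power power_mult_distrib mult_ac S_def D_def)
    have "nrm x * S < 1" using x S by (simp add: field_simps)
    moreover have "0 \<le> nrm x * S" using S by simp
    ultimately show ?thesis using geometric_bound_sums[OF b] by blast
  qed
  then obtain h where h: "\<And>x. nrm x < inverse S \<Longrightarrow> (\<lambda>j. inverse F $ j * x ^ j) sums h x" by metis
  have h: "represents U (inverse F) h"
    unfolding represents_def using S h by (intro exI[of _ "inverse S"]) auto
  have "represents U (F * inverse F) (\<lambda>x. f x * h x)" by (rule represents_mult[OF F h])
  hence "represents U (fps_const 1) (\<lambda>x. f x * h x)" using inverse_mult_eq_1'[OF F0] by simp
  then obtain r where r: "r > 0"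
    "\<And>x. x \<in> U \<Longrightarrow> 0 < nrm x \<Longrightarrow> nrm x < r \<Longrightarrow> (\<lambda>j. fps_const 1 $ j * x ^ j) sums (f x * h x)"
    unfolding represents_def by blast
  obtain s where s: "s > 0"
    "\<And>x. x \<in> U \<Longrightarrow> 0 < nrm x \<Longrightarrow> nrm x < s \<Longrightarrow> (\<lambda>j. fps_const 1 $ j * x ^ j) sums 1"
    using represents_const[of 1] unfolding represents_def by blast
  have "h x = inverse (f x)" if "x \<in> U" "0 < nrm x" "nrm x < min r s" for x
  proof -
    have "(\<lambda>j. fps_const 1 $ j * x ^ j) sums (f x * h x)" "(\<lambda>j. fps_const 1 $ j * x ^ j) sums 1"
      using r(2) s(2) that by auto
    hence "f x * h x = 1" unfolding sums_def using LIMSEQ_unique by blast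
    thus ?thesis by (metis inverse_unique)
  qed
  thus ?thesis using r s by (intro represents_cong[OF h] exI[of _ "min r s"]) auto
qed

text \<open>Where f is nonzero, f^d divided by the reflected polynomial at f is 1/p(1/f). The
  denominator is invertible as a series because its constant term is the leading coefficient of
  p.\<close>

lemma represents_recip_fps_compose:
  assumes b: "represents U b f" "b $ 0 = 0" "\<exists>r>0. \<forall>x\<in>U. 0 < nrm x \<and> nrm x < r \<longrightarrow> f x \<noteq> 0"
    and p: "p \<noteq> 0"
  shows "represents U (recip_fps p oo b) (\<lambda>x. inverse (poly p (inverse (f x))))"
proof (rule represents_cong)
  have "poly (map_poly fps_const (reflect_poly p)) b $ 0 = lead_coeff p"
  proof -
    have "poly (map_poly fps_const P) b $ 0 = coeff P 0" for P
      using b(2) by (induction P) (simp_all add: map_poly_pCons)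
    thus ?thesis by simp
  qed
  hence nz: "poly (map_poly fps_const (reflect_poly p)) b $ 0 \<noteq> 0" using p by simp
  show "represents U (recip_fps p oo b) (\<lambda>x. f x ^ degree p * inverse (poly (reflect_poly p) (f x)))"
    unfolding recip_fps_compose[OF b(2) p]
    by (intro represents_mult represents_power represents_inverse represents_poly b nz)
  obtain r where r: "r > 0" "\<And>x. x \<in> U \<Longrightarrow> 0 < nrm x \<Longrightarrow> nrm x < r \<Longrightarrow> f x \<noteq> 0"
    using b(3) by blast
  show "\<exists>r>0. \<forall>x\<in>U. 0 < nrm x \<and> nrm x < r \<longrightarrow>
      f x ^ degree p * inverse (poly (reflect_poly p) (f x)) = inverse (poly p (inverse (f x)))"
    using r by (intro exI[of _ r]) (auto simp: poly_reflect_poly_nz)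
qed

lemma represents_recip_fps:
  assumes "p \<noteq> 0"
  shows "represents U (recip_fps p) (\<lambda>x. inverse (poly p (inverse x)))"
  using represents_recip_fps_compose[OF represents_X _ _ assms] by (force intro: exI[of _ 1])

text \<open>For small x the point 1/x lies beyond all roots of p.\<close>

lemma poly_inverse_nonzero_near_0:
  assumes "p \<noteq> 0"
  shows "\<exists>r>0. \<forall>x\<in>V. 0 < nrm x \<and> nrm x < r \<longrightarrow> poly p (inverse x) \<noteq> 0"
proof -
  \<comment> \<open>The extra 0 keeps the set nonempty when p has no roots and makes the maximum
    nonnegative.\<close>
  define Z where "Z = insert 0 (nrm ` {x. poly p x = 0})"
  have fin: "finite Z" using poly_roots_finite[OF assms] by (simp add: Z_def)
  have M: "Max Z \<ge> 0" using fin by (intro Max_ge) (auto simp: Z_def)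
  have "poly p (inverse x) \<noteq> 0" if "0 < nrm x" "nrm x < inverse (1 + Max Z)" for x
  proof
    assume "poly p (inverse x) = 0"
    hence "nrm (inverse x) \<in> Z" by (auto simp: Z_def)
    hence le: "inverse (nrm x) \<le> Max Z" using fin by (simp add: nrm_inverse)
    have "nrm x * (1 + Max Z) < 1" using that M by (simp add: field_simps)
    moreover have "1 \<le> nrm x * Max Z" using le that by (simp add: field_simps)
    ultimately show False using that by (simp add: algebra_simps)
  qed
  thus ?thesis using M by (intro exI[of _ "inverse (1 + Max Z)"]) auto
qed

text \<open>Immediate for the represented functions, since the reciprocal of 1/q(1/x) is q(1/x);
  uniqueness carries it over to the series.\<close>

lemma recip_fps_compose_recip_fps:
  fixes p q :: "'c poly"
  assumes "p \<noteq> 0" "degree q > 0"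
  shows "recip_fps p oo recip_fps q = recip_fps (pcompose p q)"
proof (rule represents_unique)
  have q: "q \<noteq> 0" using assms by auto
  show "represents U (recip_fps p oo recip_fps q)
      (\<lambda>x. inverse (poly p (inverse (inverse (poly q (inverse x))))))"
    using poly_inverse_nonzero_near_0[OF q, of U] assms q
    by (intro represents_recip_fps_compose represents_recip_fps recip_fps_nth_0) auto
  have "pcompose p q \<noteq> 0" using assms pcompose_eq_0_iff[of q p] by auto
  thus "represents U (recip_fps (pcompose p q)) (\<lambda>x. inverse (poly (pcompose p q) (inverse x)))"
    by (rule represents_recip_fps)
qed (auto simp: poly_pcompose intro: exI[of _ 1])

end

end

section \<open>The Carlitz module\<close>

text \<open>Translation by 1 permutes the finite ring, so adding 1 to every element leaves the sum
  of all elements unchanged.\<close>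

lemma of_nat_CARD_eq_0: "of_nat CARD('k) = (0 :: 'k::{ring_1,finite})"
proof -
  have "(\<Sum>x\<in>UNIV. x + 1) = (\<Sum>x\<in>UNIV. x :: 'k)"
    by (rule sum.reindex_bij_witness[of _ "\<lambda>x. x - 1" "\<lambda>x. x + 1"]) auto
  thus ?thesis by (simp add: sum.distrib)
qed

lemma CARD_ge_2: "CARD('k::{zero_neq_one,finite}) \<ge> 2"
proof -
  have "card {0, 1 :: 'k} \<le> CARD('k)" by (rule card_mono) auto
  thus ?thesis by simp
qed

text \<open>The representatives of the residue classes modulo a polynomial of degree d. In terms of
  coefficients, closure under differences is immediate and 0 needs no exception.\<close>

definition polys_below :: "nat \<Rightarrow> 'k::zero poly set" where
  "polys_below d = {a. \<forall>i\<ge>d. coeff a i = 0}"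

lemma polys_below_iff: "a \<in> polys_below d \<longleftrightarrow> a = 0 \<or> degree a < d"
  unfolding polys_below_def
  by (auto simp: coeff_eq_0 le_degree) (metis leading_coeff_0_iff not_le)

lemma polys_below_Suc: "polys_below (Suc d) = (\<lambda>(c, a). pCons c a) ` (UNIV \<times> polys_below d)"
proof safe
  fix a :: "'a poly" assume a: "a \<in> polys_below (Suc d)"
  obtain c b where ab: "a = pCons c b" by (cases a) auto
  have "b \<in> polys_below d" using a by (auto simp: ab polys_below_def coeff_pCons split: nat.splits)
  thus "a \<in> (\<lambda>(c, a). pCons c a) ` (UNIV \<times> polys_below d)" using ab by auto
qed (auto simp: polys_below_def coeff_pCons split: nat.splits)

lemma card_polys_below:
  "finite (polys_below d :: 'k::{zero,finite} poly set) \<and> card (polys_below d :: 'k poly set) = CARD('k) ^ d"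
proof (induction d)
  case 0
  have "polys_below 0 = {0 :: 'k poly}" by (auto simp: polys_below_iff)
  thus ?case by simp
next
  case (Suc d)
  have "inj_on (\<lambda>(c, a). pCons c a) (UNIV \<times> polys_below d :: ('k \<times> 'k poly) set)"
    by (auto simp: inj_on_def)
  thus ?case using Suc by (simp add: polys_below_Suc card_image card_cartesian_product)
qed

section \<open>Infinite sums of power series, coefficient by coefficient\<close>

lemma has_sum_fps_iff:
  fixes F :: "'a::comm_ring_1 fps"
  shows "(h has_sum F) I \<longleftrightarrow>
     (\<forall>k. \<forall>\<^sub>F T in finite_subsets_at_top I. (\<Sum>i\<in>T. h i $ k) = F $ k)"
  by (simp add: has_sum_def tendsto_fps_iff fps_sum_nth)

lemma fps_has_sum_exists:
  fixes h :: "'i \<Rightarrow> 'a::comm_ring_1 fps"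
  assumes "\<And>k. finite {i \<in> I. h i $ k \<noteq> 0}"
  obtains F where "(h has_sum F) I"
proof -
  define F where "F = Abs_fps (\<lambda>k. \<Sum>i\<in>{i \<in> I. h i $ k \<noteq> 0}. h i $ k)"
  have "\<forall>\<^sub>F T in finite_subsets_at_top I. (\<Sum>i\<in>T. h i $ k) = F $ k" for k
    unfolding eventually_finite_subsets_at_top
    using assms[of k]
    by (intro exI[of _ "{i \<in> I. h i $ k \<noteq> 0}"]) (auto simp: F_def intro!: sum.mono_neutral_right)
  thus thesis using that[of F] by (simp add: has_sum_fps_iff)
qed

lemma fps_has_sum_unique:
  fixes F G :: "'a::comm_ring_1 fps"
  shows "(h has_sum F) I \<Longrightarrow> (h has_sum G) I \<Longrightarrow> F = G"
  using infsumI by blast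

lemma fps_has_sum_add:
  fixes F G :: "'a::comm_ring_1 fps"
  assumes "(h has_sum F) I" "(h' has_sum G) I"
  shows "((\<lambda>i. h i + h' i) has_sum (F + G)) I"
  unfolding has_sum_fps_iff
proof
  fix k
  from assms have "\<forall>\<^sub>F T in finite_subsets_at_top I. (\<Sum>i\<in>T. h i $ k) = F $ k"
    "\<forall>\<^sub>F T in finite_subsets_at_top I. (\<Sum>i\<in>T. h' i $ k) = G $ k"
    by (auto simp: has_sum_fps_iff)
  thus "\<forall>\<^sub>F T in finite_subsets_at_top I. (\<Sum>i\<in>T. (h i + h' i) $ k) = (F + G) $ k"
    by eventually_elim (simp add: sum.distrib)
qed

lemma fps_has_sum_const_mult:
  fixes F :: "'a::comm_ring_1 fps"
  assumes "(h has_sum F) I"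
  shows "((\<lambda>i. fps_const c * h i) has_sum (fps_const c * F)) I"
  unfolding has_sum_fps_iff
proof
  fix k
  from assms have "\<forall>\<^sub>F T in finite_subsets_at_top I. (\<Sum>i\<in>T. h i $ k) = F $ k"
    by (auto simp: has_sum_fps_iff)
  thus "\<forall>\<^sub>F T in finite_subsets_at_top I. (\<Sum>i\<in>T. (fps_const c * h i) $ k) = (fps_const c * F) $ k"
    by eventually_elim (simp flip: sum_distrib_left)
qed

text \<open>Coefficient k of a composition depends only on the coefficients 0..k of the outer
  series, and these finitely many stabilise together.\<close>

lemma fps_has_sum_compose:
  fixes F :: "'a::comm_ring_1 fps"
  assumes "(h has_sum F) I"
  shows "((\<lambda>i. h i oo b) has_sum (F oo b)) I"
  unfolding has_sum_fps_iff
proof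
  fix k
  have "\<forall>\<^sub>F T in finite_subsets_at_top I. \<forall>j\<in>{0..k}. (\<Sum>i\<in>T. h i $ j) = F $ j"
    using assms by (intro eventually_ball_finite) (auto simp: has_sum_fps_iff)
  thus "\<forall>\<^sub>F T in finite_subsets_at_top I. (\<Sum>i\<in>T. (h i oo b) $ k) = (F oo b) $ k"
  proof eventually_elim
    case (elim T)
    have "(\<Sum>i\<in>T. (h i oo b) $ k) = (\<Sum>j=0..k. (\<Sum>i\<in>T. h i $ j) * b ^ j $ k)"
      unfolding fps_compose_nth sum_distrib_right by (rule sum.swap)
    also have "\<dots> = (F oo b) $ k" unfolding fps_compose_nth using elim by (intro sum.cong) auto
    finally show ?case .
  qed
qed

lemma fps_has_sum_sum:
  fixes F :: "'m \<Rightarrow> 'a::comm_ring_1 fps"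
  assumes "\<And>m. m \<in> M \<Longrightarrow> (h m has_sum F m) I"
  shows "((\<lambda>i. \<Sum>m\<in>M. h m i) has_sum (\<Sum>m\<in>M. F m)) I"
  using assms
proof (induction M rule: infinite_finite_induct)
  case (insert m M)
  have "((\<lambda>i. h m i + (\<Sum>m\<in>M. h m i)) has_sum (F m + (\<Sum>m\<in>M. F m))) I"
    by (rule fps_has_sum_add) (use insert in auto)
  thus ?case using insert by simp
qed (auto simp: has_sum_fps_iff)

text \<open>Identifies the series over powers of u_g in \<open>hecke\<close> with a
  substitution.\<close>

lemma fps_compose_has_sum:
  fixes F :: "'a::comm_ring_1 fps"
  assumes "b $ 0 = 0"
  shows "((\<lambda>j. fps_const (F $ j) * b ^ j) has_sum (F oo b)) UNIV"
  unfolding has_sum_fps_iff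
proof
  fix k
  have z: "b ^ j $ k = 0" if "k < j" for j
    using startsby_zero_power_prefix[OF assms, of j] that by auto
  show "\<forall>\<^sub>F T in finite_subsets_at_top UNIV. (\<Sum>j\<in>T. (fps_const (F $ j) * b ^ j) $ k) = (F oo b) $ k"
    unfolding eventually_finite_subsets_at_top
    by (intro exI[of _ "{0..k}"])
       (auto simp: fps_compose_nth z intro!: sum.mono_neutral_right)
qed

section \<open>Carlitz polynomials\<close>

primrec carlitz_iter ::
  "('k::{field,finite} fls \<Rightarrow> 'c::{alg_closed_field,complete_space}) \<Rightarrow> nat \<Rightarrow> 'c poly" where
  "carlitz_iter emb 0 = [:0, 1:]"
| "carlitz_iter emb (Suc i) = smult (theta emb) (carlitz_iter emb i) + carlitz_iter emb i ^ CARD('k)"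

definition carlitz_poly ::
  "('k::{field,finite} fls \<Rightarrow> 'c::{alg_closed_field,complete_space}) \<Rightarrow> 'k poly \<Rightarrow> 'c poly" where
  "carlitz_poly emb a = (\<Sum>i\<le>degree a. smult (emb (fls_const (coeff a i))) (carlitz_iter emb i))"

lemma poly_carlitz_iter:
  fixes emb :: "'k::{field,finite} fls \<Rightarrow> 'c::{alg_closed_field,complete_space}"
  shows "poly (carlitz_iter emb i) x = ((\<lambda>y. theta emb * y + y ^ CARD('k)) ^^ i) x"
  by (induction i) simp_all

lemma poly_carlitz_poly: "poly (carlitz_poly emb a) x = carlitz emb a x"
  by (simp add: carlitz_poly_def carlitz_def poly_sum poly_carlitz_iter)

lemma degree_carlitz_iter:
  fixes emb :: "'k::{field,finite} fls \<Rightarrow> 'c::{alg_closed_field,complete_space}"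
  shows "degree (carlitz_iter emb i) = CARD('k) ^ i"
proof (induction i)
  case (Suc i)
  have "CARD('k) \<ge> 2" by (rule CARD_ge_2)
  moreover have "CARD('k) ^ i > 0" by simp
  ultimately have "1 * CARD('k) ^ i < CARD('k) * CARD('k) ^ i"
    by (intro mult_strict_right_mono) auto
  moreover have "degree (carlitz_iter emb i ^ CARD('k)) = CARD('k) * CARD('k) ^ i"
    using Suc by (subst degree_power_eq) auto
  moreover have "degree (smult (theta emb) (carlitz_iter emb i)) \<le> CARD('k) ^ i"
    using Suc degree_smult_le by metis
  ultimately have "degree (smult (theta emb) (carlitz_iter emb i)) < degree (carlitz_iter emb i ^ CARD('k))"
    by linarith
  hence "degree (carlitz_iter emb (Suc i)) = degree (carlitz_iter emb i ^ CARD('k))"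
    by (simp only: carlitz_iter.simps degree_add_eq_right)
  also have "\<dots> = CARD('k) ^ Suc i" using Suc by (subst degree_power_eq) auto
  finally show ?case .
qed simp

lemma coeff_carlitz_iter:
  fixes emb :: "'k::{field,finite} fls \<Rightarrow> 'c::{alg_closed_field,complete_space}"
  shows "coeff (carlitz_iter emb i) 0 = 0 \<and> coeff (carlitz_iter emb i) 1 = theta emb ^ i"
proof (induction i)
  case (Suc i)
  define p where "p = carlitz_iter emb i"
  \<comment> \<open>Writing q = m + 2 exposes two factors without constant term in the q-th power,
    which therefore contributes nothing in degrees 0 and 1.\<close>
  define m where "m = CARD('k) - 2"
  have q: "CARD('k) = Suc (Suc m)" using CARD_ge_2[where 'k = 'k] by (simp add: m_def)
  have "coeff (p ^ CARD('k)) 0 = 0" "coeff (p ^ CARD('k)) 1 = 0"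
    using Suc by (simp_all add: q p_def coeff_mult)
  thus ?case using Suc by (simp add: p_def)
qed simp

section \<open>The ring A and its norm inside the complete field\<close>

context C_infinity
begin

sublocale nonarch_field "\<lambda>x :: 'c. dist x 0"
  by unfold_locales (rule dist_diff abs_mult abs_ultra)+

abbreviation nm :: "'c \<Rightarrow> real" where "nm x \<equiv> dist x 0"

abbreviation \<kappa> :: "'k \<Rightarrow> 'c" where "\<kappa> c \<equiv> emb (fls_const c)"

lemma emb_0: "emb 0 = 0"
  using emb_add[of 0 0] by (metis add.right_neutral add_left_cancel)

lemma const_1: "\<kappa> 1 = 1"
  by (simp add: emb_1)

lemma const_add: "\<kappa> (a + b) = \<kappa> a + \<kappa> b"
  by (simp flip: fls_plus_const emb_add)

lemma const_mult: "\<kappa> (a * b) = \<kappa> a * \<kappa> b"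
  by (simp flip: emb_mult)

lemma nm_const: "c \<noteq> 0 \<Longrightarrow> nm (\<kappa> c) = 1"
  by (simp add: abs_emb)

lemma const_eq_0_iff: "\<kappa> c = 0 \<longleftrightarrow> c = 0"
  using nm_const[of c] emb_0 by (cases "c = 0") auto

lemma nm_theta: "nm (theta emb) = CARD('k)"
  by (simp add: theta_def abs_emb)

lemma of_nat_CARD_c: "of_nat CARD('k) = (0 :: 'c)"
proof -
  have "\<kappa> (of_nat m) = of_nat m" for m
    by (induction m) (simp_all add: const_add const_1 emb_0 emb_1)
  from this[of "CARD('k)"] show ?thesis by (simp add: of_nat_CARD_eq_0 emb_0)
qed

lemma ofA_pCons: "ofA emb (pCons c a) = \<kappa> c + theta emb * ofA emb a"
  by (cases "c = 0 \<and> a = 0") (auto simp: ofA_def map_poly_pCons emb_0)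

lemma ofA_0 [simp]: "ofA emb 0 = 0"
  by (simp add: ofA_def)

lemma ofA_add: "ofA emb (a + b) = ofA emb a + ofA emb b"
  by (induction a b rule: poly_induct2) (simp_all add: ofA_pCons const_add algebra_simps del: fls_plus_const)

lemma ofA_minus: "ofA emb (- a) = - ofA emb a"
  using ofA_add[of a "- a"] by (simp add: eq_neg_iff_add_eq_0 add.commute)

lemma ofA_diff: "ofA emb (a - b) = ofA emb a - ofA emb b"
  using ofA_add[of a "- b"] by (simp add: ofA_minus)

lemma ofA_smult: "ofA emb (smult c a) = \<kappa> c * ofA emb a"
  by (induction a) (simp_all add: ofA_pCons const_mult algebra_simps)

lemma ofA_mult: "ofA emb (a * b) = ofA emb a * ofA emb b"
  by (induction a) (simp_all add: ofA_pCons ofA_add ofA_smult emb_0 algebra_simps)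

lemma nm_ofA: "a \<noteq> 0 \<Longrightarrow> nm (ofA emb a) = CARD('k) ^ degree a"
proof (induction a)
  case (pCons c a)
  show ?case
  proof (cases "a = 0")
    case True
    thus ?thesis using pCons.hyps by (simp add: ofA_pCons nm_const)
  next
    case False
    have q: "real CARD('k) \<ge> 2" using CARD_ge_2[where 'k = 'k] by simp
    have n: "nm (theta emb * ofA emb a) = CARD('k) ^ Suc (degree a)"
      using False pCons.IH by (simp add: abs_mult nm_theta)
    have "nm (\<kappa> c) \<le> 1" using nm_const[of c] emb_0 by (cases "c = 0") auto
    also have "1 < real (CARD('k) ^ Suc (degree a))"
      using q by (simp only: of_nat_power) (intro one_less_power; simp)
    finally have "nm (\<kappa> c) < nm (theta emb * ofA emb a)" unfolding n by simp
    from nrm_add_eq[OF this] have "nm (ofA emb (pCons c a)) = CARD('k) ^ Suc (degree a)"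
      unfolding n by (simp add: ofA_pCons add.commute)
    thus ?thesis using False by simp
  qed
qed simp

lemma ofA_eq_0_iff [simp]: "ofA emb a = 0 \<longleftrightarrow> a = 0"
  using nm_ofA[of a] by (cases "a = 0") auto

lemma ofA_eq_iff: "ofA emb a = ofA emb b \<longleftrightarrow> a = b"
  using ofA_eq_0_iff[of "a - b"] by (simp only: ofA_diff eq_iff_diff_eq_0[symmetric] right_minus_eq)

lemma degree_carlitz_poly:
  assumes "a \<noteq> 0"
  shows "degree (carlitz_poly emb a) = CARD('k) ^ degree a"
proof -
  define d where "d = degree a"
  define t where "t i = smult (\<kappa> (coeff a i)) (carlitz_iter emb i)" for i
  have q: "CARD('k) > 1" using CARD_ge_2[where 'k = 'k] by simp
  have dl: "degree (t d) = CARD('k) ^ d"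
    using assms by (simp add: t_def d_def degree_carlitz_iter const_eq_0_iff)
  have "degree (t i) < CARD('k) ^ d" if "i < d" for i
  proof -
    have "degree (t i) \<le> CARD('k) ^ i" unfolding t_def by (metis degree_smult_le degree_carlitz_iter)
    also have "\<dots> < CARD('k) ^ d" using that q by (rule power_strict_increasing)
    finally show ?thesis .
  qed
  hence "degree (\<Sum>i<d. t i) < CARD('k) ^ d" by (intro degree_sum_less) auto
  hence "degree ((\<Sum>i<d. t i) + t d) = CARD('k) ^ d" using dl by (subst degree_add_eq_right) auto
  thus ?thesis
    by (simp add: carlitz_poly_def d_def t_def flip: lessThan_Suc_atMost)
qed

lemma carlitz_poly_nonzero: "a \<noteq> 0 \<Longrightarrow> carlitz_poly emb a \<noteq> 0"
  using degree_carlitz_poly[of a] by auto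

lemma degree_carlitz_poly_pos: "a \<noteq> 0 \<Longrightarrow> degree (carlitz_poly emb a) > 0"
  using degree_carlitz_poly[of a] by simp

text \<open>The linear coefficient will fix the scalar relating C_g to the exponential of its
  torsion.\<close>

lemma coeff_carlitz_poly_1: "coeff (carlitz_poly emb a) 1 = ofA emb a"
proof -
  have "coeff (carlitz_poly emb a) 1 = (\<Sum>i\<le>degree a. \<kappa> (coeff a i) * theta emb ^ i)"
    unfolding carlitz_poly_def coeff_sum coeff_smult using coeff_carlitz_iter by metis
  also have "\<dots> = ofA emb a"
    by (simp add: ofA_def poly_altdef degree_map_poly coeff_map_poly const_eq_0_iff emb_0)
  finally show ?thesis .
qed

text \<open>At points z whose norm avoids the norms of L, |e(z)| is at least |z|, so large such z
  give small nonzero values 1/e(z).\<close>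

lemma accum_0_inverse_image:
  assumes "discrete_subgroup L" "\<And>B. \<exists>z. nm z > B \<and> (\<forall>l\<in>L. nm l \<noteq> nm z)"
  shows "accum_0 ((\<lambda>z. inverse (lattice_exp L z)) ` (- L))"
  unfolding accum_0_def
proof (intro allI impI)
  fix r :: real assume r: "r > 0"
  obtain z where z: "nm z > inverse r" "\<And>l. l \<in> L \<Longrightarrow> nm l \<noteq> nm z" using assms(2) by blast
  have "nm (lattice_exp L z) \<ge> nm z" using nrm_lattice_exp_ge[OF assms(1) z(2)] .
  hence ge: "nm (lattice_exp L z) > inverse r" using z by linarith
  moreover have "inverse r > 0" using r by simp
  ultimately have pos: "nm (lattice_exp L z) > 0" by linarith
  have "inverse (nm (lattice_exp L z)) < inverse (inverse r)"
    using ge r by (intro less_imp_inverse_less) auto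
  thus "\<exists>x\<in>(\<lambda>z. inverse (lattice_exp L z)) ` (- L). 0 < nm x \<and> nm x < r"
    using pos z(2) by (intro bexI[of _ "inverse (lattice_exp L z)"]) (auto simp: nrm_inverse)
qed

lemma accum_0_finite:
  assumes "finite S" "additive_subgroup S"
  shows "accum_0 ((\<lambda>z. inverse (lattice_exp S z)) ` (- S))"
proof (rule accum_0_inverse_image)
  show "discrete_subgroup S" using assms by (simp add: discrete_subgroup_def)
  fix B :: real
  have S: "nm ` S \<noteq> {}" "finite (nm ` S)" using assms additive_subgroup_0 by auto
  have "real CARD('k) > 1" using CARD_ge_2[where 'k = 'k] by simp
  then obtain m where m: "real CARD('k) ^ m > max B (Max (nm ` S))"
    using real_arch_pow by blast
  have "nm (theta emb ^ m) > max B (Max (nm ` S))" using m by (simp add: nrm_power nm_theta)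
  moreover have "nm l \<le> Max (nm ` S)" if "l \<in> S" for l using S that by (intro Max_ge) auto
  ultimately show "\<exists>z. nm z > B \<and> (\<forall>l\<in>S. nm l \<noteq> nm z)"
    by (intro exI[of _ "theta emb ^ m"]) fastforce
qed

end

section \<open>The period lattice and the torsion of the Carlitz module\<close>

locale carlitz_lattice = C_infinity emb
  for emb :: "'k::{field,finite} fls \<Rightarrow> 'c::{alg_closed_field,complete_space}" +
  fixes w :: 'c
  assumes period: "carlitz_period emb w"
begin

abbreviation \<Lambda> :: "'c set" where "\<Lambda> \<equiv> lattice_of emb w"
abbreviation e :: "'c \<Rightarrow> 'c" where "e \<equiv> lattice_exp \<Lambda>"

lemma w_nonzero: "w \<noteq> 0"
  using period by (simp add: carlitz_period_def)

lemma e_ofA_mult: "e (ofA emb a * z) = poly (carlitz_poly emb a) (e z)"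
  using period by (simp add: carlitz_period_def poly_carlitz_poly)

lemma discrete_lattice: "discrete_subgroup \<Lambda>"
  unfolding discrete_subgroup_def
proof (intro conjI allI)
  have "ofA emb a * w - ofA emb b * w \<in> \<Lambda>" for a b
    unfolding lattice_of_def by (rule image_eqI[of _ _ "a - b"]) (simp_all add: ofA_diff left_diff_distrib)
  moreover have "0 \<in> \<Lambda>" by (auto simp: lattice_of_def intro!: image_eqI[of _ _ 0])
  ultimately show "additive_subgroup \<Lambda>"
    by (auto simp: additive_subgroup_def lattice_of_def)
  fix r :: real
  obtain d where d: "r / nm w < real CARD('k) ^ d"
    using real_arch_pow[of "real CARD('k)"] CARD_ge_2[where 'k = 'k] by auto
  have wp: "nm w > 0" using w_nonzero by simp
  have "{l \<in> \<Lambda>. nm l \<le> r} \<subseteq> (\<lambda>a. ofA emb a * w) ` polys_below d"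
  proof
    fix l assume "l \<in> {l \<in> \<Lambda>. nm l \<le> r}"
    then obtain a where a: "l = ofA emb a * w" "nm l \<le> r" by (auto simp: lattice_of_def)
    have "a \<in> polys_below d"
    proof (cases "a = 0")
      case False
      have "real CARD('k) ^ degree a * nm w \<le> r" using a False by (simp add: abs_mult nm_ofA)
      hence "real CARD('k) ^ degree a \<le> r / nm w" using wp by (simp add: field_simps)
      hence "real CARD('k) ^ degree a < real CARD('k) ^ d" using d by linarith
      hence "degree a < d" using CARD_ge_2[where 'k = 'k] by (subst (asm) power_strict_increasing_iff) auto
      thus ?thesis by (simp add: polys_below_iff)
    qed (simp add: polys_below_iff)
    thus "l \<in> (\<lambda>a. ofA emb a * w) ` polys_below d" using a by blast
  qed
  thus "finite {l \<in> \<Lambda>. nm l \<le> r}"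
    using card_polys_below finite_subset by blast
qed

lemma e_eq_0_iff: "e z = 0 \<longleftrightarrow> z \<in> \<Lambda>"
  by (rule lattice_exp_eq_0_iff[OF discrete_lattice])

lemma e_add: "e (x + y) = e x + e y"
  by (rule lattice_exp_add[OF discrete_lattice])

lemma e_diff: "e (x - y) = e x - e y"
  by (rule lattice_exp_diff[OF discrete_lattice])

definition u_values :: "'c set" where
  "u_values = (\<lambda>z. inverse (e z)) ` (- \<Lambda>)"

text \<open>The norms of \<open>w y \<theta>\<^sup>m\<close> with \<open>y\<^sup>2 = \<theta>\<close> are unbounded and avoid those of \<open>\<Lambda>\<close>, by parity.\<close>

lemma accum_0_u_values: "accum_0 u_values"
  unfolding u_values_def
proof (rule accum_0_inverse_image[OF discrete_lattice])
  fix B :: real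
  define q where "q = real CARD('k)"
  have q: "q > 1" using CARD_ge_2[where 'k = 'k] by (simp add: q_def)
  have wp: "nm w > 0" using w_nonzero by simp
  obtain y where y: "y ^ 2 = theta emb" using nth_root_exists[of 2 "theta emb"] by auto
  have ny: "nm y ^ 2 = q" using y nm_theta by (metis nrm_power q_def)
  hence ny1: "nm y > 1" using q by (metis nrm_ge_0 not_le power_le_one)
  obtain m where m: "B / nm w < q ^ m" using real_arch_pow[OF q] by blast
  define z where "z = w * y * theta emb ^ m"
  have nz: "nm z = nm w * nm y * q ^ m"
    by (simp add: z_def abs_mult nrm_power nm_theta q_def)
  have "B < nm w * q ^ m" using m wp by (simp add: field_simps)
  also have "\<dots> \<le> nm w * nm y * q ^ m"
    using ny1 wp q by (simp add: mult_le_cancel_right1)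
  finally have "B < nm z" using nz by simp
  moreover have "nm l \<noteq> nm z" if l: "l \<in> \<Lambda>" for l
  proof
    assume eq: "nm l = nm z"
    obtain a where a: "l = ofA emb a * w" using l unfolding lattice_of_def by blast
    have zp: "nm z > 0"
      unfolding nz using wp ny1 q by (intro mult_pos_pos zero_less_power) auto
    hence "a \<noteq> 0" using a eq by auto
    hence "q ^ degree a = nm y * q ^ m"
      using eq wp by (simp add: a nz abs_mult nm_ofA q_def)
    hence "(q ^ degree a) ^ 2 = (nm y * q ^ m) ^ 2" by simp
    hence "q ^ (2 * degree a) = q ^ (2 * m + 1)"
      using ny by (simp add: power_mult_distrib power_even_eq power2_eq_square)
    hence "2 * degree a = 2 * m + 1" using q by (subst (asm) power_inject_exp) auto
    thus False by presburger
  qed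
  ultimately show "\<exists>z. nm z > B \<and> (\<forall>l\<in>\<Lambda>. nm l \<noteq> nm z)" by blast
qed

text \<open>Allows identities between Carlitz polynomials to be verified at the points e(z), where
  they follow from e(a z) = C_a(e(z)).\<close>

lemma infinite_range_e: "infinite (range e)"
proof
  assume "finite (range e)"
  hence "finite (inverse ` range e)" by simp
  moreover have "{x \<in> u_values. 0 < nm x \<and> nm x < 1} \<subseteq> inverse ` range e"
    by (auto simp: u_values_def)
  ultimately show False
    using accum_0_infinite[OF accum_0_u_values, of 1] finite_subset by auto
qed

lemma carlitz_poly_mult: "carlitz_poly emb (a * b) = pcompose (carlitz_poly emb a) (carlitz_poly emb b)"
proof (rule poly_eqI_infinite[OF infinite_range_e])
  fix x assume "x \<in> range e"
  then obtain z where "x = e z" by blast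
  thus "poly (carlitz_poly emb (a * b)) x = poly (pcompose (carlitz_poly emb a) (carlitz_poly emb b)) x"
    using e_ofA_mult[of "a * b" z] e_ofA_mult[of a "ofA emb b * z"] e_ofA_mult[of b z]
    by (simp add: poly_pcompose ofA_mult mult.assoc)
qed

text \<open>The additivity of C_a, inherited from that of e. Values \<mu> of e are general enough,
  since all torsion points are of this form.\<close>

lemma carlitz_poly_translate:
  assumes "\<mu> \<in> range e"
  shows "pcompose (carlitz_poly emb a) [:\<mu>, 1:]
       = pcompose [:poly (carlitz_poly emb a) \<mu>, 1:] (carlitz_poly emb a)"
proof (rule poly_eqI_infinite[OF infinite_range_e])
  fix x assume "x \<in> range e"
  then obtain z z' where z: "x = e z" "\<mu> = e z'" using assms by blast
  have "poly (carlitz_poly emb a) (\<mu> + x) = e (ofA emb a * z' + ofA emb a * z)"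
    by (simp add: z e_add[symmetric] e_ofA_mult[symmetric] algebra_simps)
  thus "poly (pcompose (carlitz_poly emb a) [:\<mu>, 1:]) x
      = poly (pcompose [:poly (carlitz_poly emb a) \<mu>, 1:] (carlitz_poly emb a)) x"
    by (simp add: poly_pcompose z e_add e_ofA_mult)
qed

text \<open>The analytic form e(b w / g) of the torsion: b modulo g parametrises it, and C_a acts as
  multiplication of b by a.\<close>

definition torsion :: "'k poly \<Rightarrow> 'k poly \<Rightarrow> 'c" where
  "torsion g b = e (ofA emb b * (w / ofA emb g))"

lemma torsion_diff: "torsion g (b - c) = torsion g b - torsion g c"
  unfolding torsion_def ofA_diff left_diff_distrib by (rule e_diff)

lemma torsion_eq_0_iff:
  assumes "g \<noteq> 0"
  shows "torsion g b = 0 \<longleftrightarrow> g dvd b"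
proof -
  have "torsion g b = 0 \<longleftrightarrow> (\<exists>c. ofA emb b * (w / ofA emb g) = ofA emb c * w)"
    unfolding torsion_def e_eq_0_iff by (auto simp: lattice_of_def)
  also have "\<dots> \<longleftrightarrow> (\<exists>c. ofA emb b = ofA emb (g * c))"
    using assms w_nonzero by (simp add: field_simps ofA_mult)
  also have "\<dots> \<longleftrightarrow> g dvd b" by (auto simp: ofA_eq_iff dvd_def)
  finally show ?thesis .
qed

lemma carlitz_torsion: "poly (carlitz_poly emb a) (torsion g b) = torsion g (a * b)"
  by (simp add: torsion_def ofA_mult mult.assoc flip: e_ofA_mult)

text \<open>The q^d residues b modulo g, where d = deg g, give distinct roots of C_g, and the degree
  of C_g allows no more. Hence every root has this form.\<close>

lemma torsion_props:
  assumes g: "g \<noteq> 0"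
  shows "bij_betw (torsion g) (polys_below (degree g)) (division_points emb g)"
    and "division_points emb g = range (torsion g)"
    and "finite (division_points emb g)"
    and "card (division_points emb g) = CARD('k) ^ degree g"
proof -
  define D where "D = division_points emb g"
  define B where "B = (polys_below (degree g) :: 'k poly set)"
  have D: "D = {x. poly (carlitz_poly emb g) x = 0}"
    by (simp add: D_def division_points_def poly_carlitz_poly)
  have finD: "finite D" unfolding D using carlitz_poly_nonzero[OF g] by (rule poly_roots_finite)
  have cD: "card D \<le> CARD('k) ^ degree g"
    unfolding D using card_poly_roots_bound[OF carlitz_poly_nonzero[OF g]] degree_carlitz_poly[OF g] by simp
  have sub: "range (torsion g) \<subseteq> D"
    using torsion_eq_0_iff[OF g] by (auto simp: D carlitz_torsion)
  have inj: "inj_on (torsion g) B"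
  proof (rule inj_onI)
    fix b c assume bc: "b \<in> B" "c \<in> B" "torsion g b = torsion g c"
    hence "g dvd b - c" using torsion_eq_0_iff[OF g, of "b - c"] by (simp add: torsion_diff)
    moreover have "b - c \<in> polys_below (degree g)" using bc by (simp add: B_def polys_below_def)
    ultimately have "b - c = 0" by (metis dvd_imp_degree_le not_le polys_below_iff)
    thus "b = c" by simp
  qed
  have "card (torsion g ` B) = CARD('k) ^ degree g"
    using inj card_polys_below[where 'k = 'k] by (simp add: card_image B_def)
  moreover have "torsion g ` B \<subseteq> D" using sub by auto
  ultimately have im: "torsion g ` B = D"
    using finD cD card_mono[OF finD, of "torsion g ` B"] by (intro card_subset_eq) auto
  show "bij_betw (torsion g) (polys_below (degree g)) (division_points emb g)"
    using inj im by (simp add: bij_betw_def B_def D_def)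
  show "division_points emb g = range (torsion g)" using sub im D_def by blast
  show "finite (division_points emb g)" using finD by (simp add: D_def)
  show "card (division_points emb g) = CARD('k) ^ degree g"
    using \<open>card (torsion g ` B) = _\<close> im by (simp add: D_def)
qed

lemma additive_subgroup_division_points:
  assumes "g \<noteq> 0"
  shows "additive_subgroup (division_points emb g)"
proof -
  have "0 = torsion g 0" using torsion_eq_0_iff[OF assms, of 0] by simp
  thus ?thesis
    unfolding torsion_props(2)[OF assms] additive_subgroup_def
    by (auto simp: torsion_diff[symmetric])
qed

text \<open>Both polynomials vanish on the q^d torsion points and have degree q^d, so they are
  proportional; the linear coefficients g and 1 give the scalar.\<close>

lemma carlitz_poly_eq_expo:
  assumes g: "g \<noteq> 0"
  shows "carlitz_poly emb g = smult (ofA emb g) (expo (division_points emb g))"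
proof -
  define D where "D = division_points emb g"
  define E where "E = expo D"
  define n where "n = CARD('k) ^ degree g"
  note D_props = torsion_props(3,4)[OF g, folded D_def] additive_subgroup_division_points[OF g, folded D_def]
  have D0: "0 \<in> D" using D_props(3) additive_subgroup_0 by blast
  have degE: "degree E = n" using degree_expo[OF D_props(1) D0] D_props(2) by (simp add: E_def n_def)
  have degC: "degree (carlitz_poly emb g) = n" using degree_carlitz_poly[OF g] by (simp add: n_def)
  have "E \<noteq> 0" using degE by (auto simp: n_def)
  hence lE: "coeff E n \<noteq> 0" using degE by auto
  define c where "c = coeff (carlitz_poly emb g) n / coeff E n"
  have "carlitz_poly emb g = smult c E"
  proof (rule poly_eqI_degree_lead_coeff[where n = n and A = D])
    show "poly (carlitz_poly emb g) z = poly (smult c E) z" if "z \<in> D" for z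
      using that poly_expo_eq_0_iff[OF D_props(1) D0, of z]
      by (auto simp: D_def division_points_def poly_carlitz_poly E_def)
  qed (use degE degC lE D_props(2) in \<open>auto simp: c_def n_def intro: order.trans[OF degree_smult_le]\<close>)
  moreover from this have "c = ofA emb g"
    using coeff_carlitz_poly_1[of g] coeff_expo_1[of D] by (simp add: E_def)
  ultimately show ?thesis by (simp add: E_def D_def)
qed

end

section \<open>The Hecke operator\<close>

context nonarch_field
begin

lemma na_has_sum_add:
  fixes f g :: "'b \<Rightarrow> 'c"
  assumes "(f has_sum a) A" "(g has_sum b) A"
  shows "((\<lambda>x. f x + g x) has_sum (a + b)) A"
proof -
  have "sum (\<lambda>x. f x + g x) = (\<lambda>T. sum f T + sum g T)" by (rule ext) (rule sum.distrib)
  thus ?thesis using na_tendsto_add[OF assms[unfolded has_sum_def]] by (simp add: has_sum_def)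
qed

lemma na_has_sum_cmult:
  fixes f :: "'b \<Rightarrow> 'c"
  assumes "(f has_sum a) A"
  shows "((\<lambda>x. c * f x) has_sum (c * a)) A"
proof -
  have "sum (\<lambda>x. c * f x) = (\<lambda>T. c * sum f T)" by (rule ext) (rule sum_distrib_left[symmetric])
  thus ?thesis
    using na_tendsto_mult[OF tendsto_const assms[unfolded has_sum_def], of c] by (simp add: has_sum_def)
qed

lemma na_has_sum_Un_disjoint:
  fixes f :: "'b \<Rightarrow> 'c"
  assumes "(f has_sum a) A" "(f has_sum b) B" "A \<inter> B = {}"
  shows "(f has_sum (a + b)) (A \<union> B)"
proof -
  have "((\<lambda>x. if x \<in> A then f x else 0) has_sum a) (A \<union> B)"
    by (rule has_sum_cong_neutral[THEN iffD1, OF _ _ _ assms(1)]) auto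
  moreover have "((\<lambda>x. if x \<in> B then f x else 0) has_sum b) (A \<union> B)"
    by (rule has_sum_cong_neutral[THEN iffD1, OF _ _ _ assms(2)]) auto
  ultimately have "((\<lambda>x. (if x \<in> A then f x else 0) + (if x \<in> B then f x else 0)) has_sum (a + b)) (A \<union> B)"
    by (rule na_has_sum_add)
  thus ?thesis by (rule has_sum_cong[THEN iffD1, rotated]) (use assms(3) in auto)
qed

lemma na_has_sum_UN_disjoint:
  fixes f :: "'b \<Rightarrow> 'c"
  assumes "finite I" "\<And>i. i \<in> I \<Longrightarrow> (f has_sum s i) (A i)" "disjoint_family_on A I"
  shows "(f has_sum (\<Sum>i\<in>I. s i)) (\<Union>i\<in>I. A i)"
  using assms
proof (induction I)
  case (insert i I)
  have "(f has_sum (s i + (\<Sum>i\<in>I. s i))) (A i \<union> (\<Union>i\<in>I. A i))"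
  proof (rule na_has_sum_Un_disjoint)
    show "A i \<inter> (\<Union>i\<in>I. A i) = {}"
    proof -
      have "A i \<inter> A j = {}" if "j \<in> I" for j
        using insert.hyps(2) insert.prems(2) that unfolding disjoint_family_on_def by (metis insertCI)
      thus ?thesis by blast
    qed
    show "(f has_sum (\<Sum>i\<in>I. s i)) (\<Union>i\<in>I. A i)"
      using insert.prems by (intro insert.IH) (auto simp: disjoint_family_on_def)
    show "(f has_sum s i) (A i)" by (rule insert.prems(1)) simp
  qed
  thus ?case using insert.hyps by simp
qed simp

end

section \<open>The series of u_a and of the translates of u\<close>

context carlitz_lattice
begin

definition carlitz_u :: "'k poly \<Rightarrow> 'c fps" where
  "carlitz_u a = recip_fps (carlitz_poly emb a)"

text \<open>For u = 1/e(z) and \<mu> = e(y) this expands 1/e(z + y), the translate of u by y, in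
  powers of u.\<close>

definition shift_u :: "'c \<Rightarrow> 'c fps" where
  "shift_u \<mu> = recip_fps [:\<mu>, 1:]"

lemma carlitz_u_nth_0: "a \<noteq> 0 \<Longrightarrow> carlitz_u a $ 0 = 0"
  unfolding carlitz_u_def by (intro recip_fps_nth_0 degree_carlitz_poly_pos)

lemma shift_u_nth_0: "shift_u \<mu> $ 0 = 0"
  unfolding shift_u_def by (rule recip_fps_nth_0) simp

lemma represents_carlitz_u:
  "a \<noteq> 0 \<Longrightarrow> represents u_values (carlitz_u a) (\<lambda>x. inverse (poly (carlitz_poly emb a) (inverse x)))"
  unfolding carlitz_u_def
  by (rule represents_recip_fps[OF accum_0_u_values carlitz_poly_nonzero])

lemma represents_shift_u: "represents u_values (shift_u \<mu>) (\<lambda>x. inverse (inverse x + \<mu>))"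
  unfolding shift_u_def using represents_recip_fps[OF accum_0_u_values, of "[:\<mu>, 1:]"]
  by (simp add: add.commute)

lemma carlitz_u_compose:
  assumes "a \<noteq> 0" "b \<noteq> 0"
  shows "carlitz_u a oo carlitz_u b = carlitz_u (a * b)"
  unfolding carlitz_u_def carlitz_poly_mult
  by (rule recip_fps_compose_recip_fps[OF accum_0_u_values])
     (simp_all only: assms carlitz_poly_nonzero degree_carlitz_poly_pos not_False_eq_True)

lemma carlitz_u_shift:
  assumes "a \<noteq> 0" "\<mu> \<in> range e"
  shows "carlitz_u a oo shift_u \<mu> = shift_u (poly (carlitz_poly emb a) \<mu>) oo carlitz_u a"
proof -
  have "carlitz_u a oo shift_u \<mu> = recip_fps (pcompose (carlitz_poly emb a) [:\<mu>, 1:])"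
    unfolding carlitz_u_def shift_u_def
    by (rule recip_fps_compose_recip_fps[OF accum_0_u_values])
       (use assms carlitz_poly_nonzero in auto)
  also have "\<dots> = shift_u (poly (carlitz_poly emb a) \<mu>) oo carlitz_u a"
    unfolding carlitz_poly_translate[OF assms(2)] carlitz_u_def shift_u_def
    by (rule recip_fps_compose_recip_fps[OF accum_0_u_values, symmetric])
       (use assms degree_carlitz_poly_pos in auto)
  finally show ?thesis .
qed

lemma shift_u_0: "shift_u 0 = fps_X"
proof -
  have "reflect_poly [:0, 1 :: 'c:] = 1"
    by (simp add: reflect_poly_def one_pCons)
  thus ?thesis by (simp add: shift_u_def recip_fps_def)
qed

lemma u_param_eq: "u_param emb w z = inverse (e (w * z))"
  by (simp add: u_param_def)

text \<open>On values x of u the function to be expanded is 1/C_a(1/x), by the functional equation,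
  so the description in \<open>u_expansion\<close> asks for the unique series representing
  it.\<close>

lemma u_at_eq:
  assumes a: "a \<noteq> 0"
  shows "u_at emb w a = carlitz_u a"
proof -
  define f where "f x = inverse (poly (carlitz_poly emb a) (inverse x))" for x
  have val: "f (u_param emb w z) = u_param emb w (ofA emb a * z)" for z
    using e_ofA_mult[of a "w * z"] by (simp add: f_def u_param_eq mult.left_commute)
  \<comment> \<open>As \<open>inverse\<close> sends 0 to 0, u(z) = 0 holds exactly when w z is a
    lattice point; and z \<mapsto> w z is onto because w is nonzero.\<close>
  have uv: "u_values = {u_param emb w z |z. u_param emb w z \<noteq> 0}"
  proof -
    have "x \<in> u_values \<longleftrightarrow> (\<exists>z. x = inverse (e (w * z)) \<and> e (w * z) \<noteq> 0)" for x
    proof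
      assume "x \<in> u_values"
      then obtain y where y: "x = inverse (e y)" "y \<notin> \<Lambda>" by (auto simp: u_values_def)
      thus "\<exists>z. x = inverse (e (w * z)) \<and> e (w * z) \<noteq> 0"
        using w_nonzero e_eq_0_iff by (intro exI[of _ "y / w"]) auto
    next
      assume "\<exists>z. x = inverse (e (w * z)) \<and> e (w * z) \<noteq> 0"
      thus "x \<in> u_values" unfolding u_values_def using e_eq_0_iff by blast
    qed
    thus ?thesis by (auto simp: u_param_eq)
  qed
  have iff: "(\<exists>r>0. \<forall>z. u_param emb w z \<noteq> 0 \<and> dist (u_param emb w z) 0 < r \<longrightarrow>
     (\<lambda>j. fps_nth F j * u_param emb w z ^ j) sums u_param emb w (ofA emb a * z)) \<longleftrightarrow> represents u_values F f" for F
  proof -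
    have "(\<forall>z. u_param emb w z \<noteq> 0 \<and> nm (u_param emb w z) < r \<longrightarrow> Q (u_param emb w z)) \<longleftrightarrow>
        (\<forall>x\<in>u_values. 0 < nm x \<and> nm x < r \<longrightarrow> Q x)" for r Q
      unfolding uv nrm_pos_iff by blast
    from this[of _ "\<lambda>x. (\<lambda>j. fps_nth F j * x ^ j) sums f x"]
    show ?thesis unfolding represents_def val[symmetric] by (simp only:)
  qed
  have rep: "represents u_values (carlitz_u a) f"
    using represents_carlitz_u[OF a] by (simp add: f_def[abs_def])
  show ?thesis
    unfolding u_at_def u_expansion_def iff
  proof (rule the_equality)
    fix F assume "represents u_values F f"
    thus "F = carlitz_u a"
      by (rule represents_unique[OF accum_0_u_values _ rep]) (intro exI[of _ 1], simp)
  qed (rule rep)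
qed

lemma division_points_subset: "g \<noteq> 0 \<Longrightarrow> division_points emb g \<subseteq> range e"
  unfolding torsion_props(2) by (auto simp: torsion_def)

lemma goss_division_points:
  assumes g: "g \<noteq> 0" and j: "j > 0"
  shows "goss_poly j (division_points emb g)
       = goss_sum j (\<lambda>i. coeff (expo (division_points emb g) ^ i) (j - 1))"
    "z \<notin> division_points emb g \<Longrightarrow>
      poly (goss_poly j (division_points emb g)) (inverse (poly (expo (division_points emb g)) z))
        = (\<Sum>\<mu>\<in>division_points emb g. inverse ((z + \<mu>) ^ j))"
proof -
  note D = torsion_props(3)[OF g] additive_subgroup_division_points[OF g]
  show eq: "goss_poly j (division_points emb g)
       = goss_sum j (\<lambda>i. coeff (expo (division_points emb g) ^ i) (j - 1))"
    by (rule goss_poly_finite[OF D j accum_0_finite[OF D]])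
  show "poly (goss_poly j (division_points emb g)) (inverse (poly (expo (division_points emb g)) z))
        = (\<Sum>\<mu>\<in>division_points emb g. inverse ((z + \<mu>) ^ j))" if "z \<notin> division_points emb g"
    unfolding eq by (rule finite_goss_identity[OF D that j, symmetric])
qed

text \<open>Since C_g is g times the exponential e of the torsion, g u_g = 1/e(1/u), the argument to
  which the finite Goss identity applies. This explains the factor g inside
  \<open>hecke_hat\<close>.\<close>

lemma goss_pcompose_compose:
  assumes g: "g \<noteq> 0" and j: "j > 0"
  shows "fps_of_poly (pcompose (goss_poly j (division_points emb g)) [:0, ofA emb g:]) oo carlitz_u g
       = (\<Sum>\<mu>\<in>division_points emb g. shift_u \<mu> ^ j)"
proof (rule represents_unique[OF accum_0_u_values])
  define P where "P = pcompose (goss_poly j (division_points emb g)) [:0, ofA emb g:]"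
  show "represents u_values (fps_of_poly P oo carlitz_u g)
          (\<lambda>x. poly P (inverse (poly (carlitz_poly emb g) (inverse x))))"
    unfolding fps_of_poly_compose[OF carlitz_u_nth_0[OF g]]
    by (intro represents_poly accum_0_u_values represents_carlitz_u g)
  show "represents u_values (\<Sum>\<mu>\<in>division_points emb g. shift_u \<mu> ^ j)
          (\<lambda>x. \<Sum>\<mu>\<in>division_points emb g. inverse (inverse x + \<mu>) ^ j)"
    by (intro represents_sum represents_power represents_shift_u accum_0_u_values)
  obtain r where r: "r > 0"
    "\<And>x. x \<in> u_values \<Longrightarrow> 0 < nm x \<Longrightarrow> nm x < r \<Longrightarrow> poly (carlitz_poly emb g) (inverse x) \<noteq> 0"
    using poly_inverse_nonzero_near_0[OF accum_0_u_values carlitz_poly_nonzero[OF g], of u_values] by blast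
  have "poly P (inverse (poly (carlitz_poly emb g) (inverse x)))
      = (\<Sum>\<mu>\<in>division_points emb g. inverse (inverse x + \<mu>) ^ j)"
    if "x \<in> u_values" "0 < nm x" "nm x < r" for x
  proof -
    have "inverse x \<notin> division_points emb g"
      using r(2)[OF that] by (simp add: division_points_def poly_carlitz_poly)
    note goss_division_points(2)[OF g j this]
    moreover have "ofA emb g * inverse (poly (carlitz_poly emb g) (inverse x))
        = inverse (poly (expo (division_points emb g)) (inverse x))"
      using g by (simp add: carlitz_poly_eq_expo)
    ultimately show ?thesis by (simp add: P_def poly_pcompose mult.commute power_inverse)
  qed
  thus "\<exists>r>0. \<forall>x\<in>u_values. 0 < nm x \<and> nm x < r \<longrightarrow>
      poly P (inverse (poly (carlitz_poly emb g) (inverse x)))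
      = (\<Sum>\<mu>\<in>division_points emb g. inverse (inverse x + \<mu>) ^ j)"
    using r(1) by blast
qed

lemma hecke_hat_compose:
  assumes g: "g \<noteq> 0" and F0: "F $ 0 = 0"
  shows "hecke_hat emb g F oo carlitz_u g = (\<Sum>\<mu>\<in>division_points emb g. F oo shift_u \<mu>)"
proof -
  define D where "D = division_points emb g"
  define P where "P j = pcompose (goss_poly j D) [:0, ofA emb g:]" for j
  define h where "h j = fps_const (F $ j) * fps_of_poly (P j)" for j
  \<comment> \<open>For summability: up to a power of g, the coefficient of u^k in the term j
    involves that of T^(j-1) in e^(k-1), which vanishes once j - 1 exceeds (k - 1) deg e.\<close>
  have fin: "finite {j \<in> {1..}. h j $ k \<noteq> 0}" for k
  proof (rule finite_subset)
    show "{j \<in> {1..}. h j $ k \<noteq> 0} \<subseteq> {..Suc ((k - 1) * degree (expo D))}"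
    proof
      fix j assume "j \<in> {j \<in> {1..}. h j $ k \<noteq> 0}"
      hence j: "j > 0" and "coeff (P j) k \<noteq> 0" by (auto simp: h_def)
      hence "coeff (goss_poly j D) k \<noteq> 0" by (auto simp: P_def coeff_pcompose_linear)
      hence "coeff (expo D ^ (k - 1)) (j - 1) \<noteq> 0"
        unfolding D_def goss_division_points(1)[OF g j] coeff_goss_sum by (auto split: if_splits)
      hence "j - 1 \<le> degree (expo D ^ (k - 1))" by (rule le_degree)
      also have "\<dots> \<le> (k - 1) * degree (expo D)"
        using degree_power_le[of "expo D" "k - 1"] by (simp add: mult.commute)
      finally show "j \<in> {..Suc ((k - 1) * degree (expo D))}" by simp
    qed
  qed simp
  obtain H where H: "(h has_sum H) {1..}" using fps_has_sum_exists[OF fin] by blast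
  have "hecke_hat emb g F = H"
    unfolding hecke_hat_def using infsumI[OF H] by (simp add: h_def[abs_def] P_def D_def)
  moreover have "((\<lambda>j. h j oo carlitz_u g) has_sum (H oo carlitz_u g)) {1..}"
    by (rule fps_has_sum_compose[OF H])
  moreover have "((\<lambda>j. h j oo carlitz_u g) has_sum (\<Sum>\<mu>\<in>D. F oo shift_u \<mu>)) {1..}"
  proof -
    have "((\<lambda>j. \<Sum>\<mu>\<in>D. fps_const (F $ j) * shift_u \<mu> ^ j) has_sum (\<Sum>\<mu>\<in>D. F oo shift_u \<mu>)) UNIV"
      by (intro fps_has_sum_sum fps_compose_has_sum shift_u_nth_0)
    hence "((\<lambda>j. \<Sum>\<mu>\<in>D. fps_const (F $ j) * shift_u \<mu> ^ j) has_sum (\<Sum>\<mu>\<in>D. F oo shift_u \<mu>)) {1..}"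
    proof (rule has_sum_cong_neutral[THEN iffD1, rotated -1])
      fix j :: nat assume "j \<in> UNIV - {1..}"
      hence "j = 0" by auto
      thus "(\<Sum>\<mu>\<in>D. fps_const (F $ j) * shift_u \<mu> ^ j) = 0" using F0 by simp
    qed auto
    thus ?thesis
    proof (rule has_sum_cong[THEN iffD1, rotated])
      fix j :: nat assume "j \<in> {1..}"
      thus "(\<Sum>\<mu>\<in>D. fps_const (F $ j) * shift_u \<mu> ^ j) = h j oo carlitz_u g"
        using goss_pcompose_compose[OF g, of j]
        by (simp add: h_def P_def D_def fps_compose_mult_distrib carlitz_u_nth_0[OF g] sum_distrib_left)
    qed
  qed
  ultimately show ?thesis using fps_has_sum_unique unfolding D_def by blast
qed

lemma has_sum_lattice_of:
  "(f has_sum s) \<Lambda> \<longleftrightarrow> ((\<lambda>a. f (ofA emb a * w)) has_sum s) UNIV"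
proof -
  have "inj (\<lambda>a. ofA emb a * w)" using w_nonzero by (auto simp: inj_on_def ofA_eq_iff)
  thus ?thesis unfolding lattice_of_def by (subst has_sum_reindex) (simp_all add: o_def)
qed

section \<open>The Goss polynomial of the Carlitz lattice and the eigenvalue\<close>

context
  fixes n :: nat
  assumes n: "n > 0"
begin

abbreviation G :: "'c poly" where "G \<equiv> goss_poly n \<Lambda>"

lemma goss_lattice_correct:
  "coeff G 0 = 0"
  "z \<notin> \<Lambda> \<Longrightarrow> ((\<lambda>l. inverse ((z + l) ^ n)) has_sum poly G (inverse (e z))) \<Lambda>"
  using goss_poly_correct[OF discrete_lattice accum_0_u_values[unfolded u_values_def] n] by auto

lemma goss_lattice_has_sum:
  assumes "z \<notin> \<Lambda>"
  shows "((\<lambda>a. inverse ((z + ofA emb a * w) ^ n)) has_sum poly G (inverse (e z))) UNIV"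
  using has_sum_lattice_of[of "\<lambda>l. inverse ((z + l) ^ n)" "poly G (inverse (e z))"]
    goss_lattice_correct(2)[OF assms] by (rule iffD1)

text \<open>The sum over \<open>A\<close> on the right splits into the residue classes modulo \<open>g\<close>, each of which is
  a scaled sum over \<open>A\<close> at the point \<open>z + b w/g\<close>.\<close>

lemma goss_distribution:
  assumes g: "g \<noteq> 0" and z: "ofA emb g * z \<notin> \<Lambda>"
  shows "(\<Sum>\<mu>\<in>division_points emb g. poly G (inverse (e z + \<mu>)))
       = ofA emb g ^ n * poly G (inverse (e (ofA emb g * z)))"
proof -
  define \<gamma> where "\<gamma> = ofA emb g"
  have \<gamma>: "\<gamma> \<noteq> 0" using g by (simp add: \<gamma>_def)
  define B where "B = (polys_below (degree g) :: 'k poly set)"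
  define f where "f a = inverse ((\<gamma> * z + ofA emb a * w) ^ n)" for a
  define s where "s b = poly G (inverse (e z + torsion g b))" for b
  have finB: "finite B" using card_polys_below[where 'k = 'k] by (simp add: B_def)
  have part: "(f has_sum (inverse (\<gamma> ^ n) * s b)) (range (\<lambda>c. b + g * c))" for b
  proof -
    define y where "y = z + ofA emb b * (w / \<gamma>)"
    have \<gamma>y: "\<gamma> * y = \<gamma> * z + ofA emb b * w" using \<gamma> by (simp add: y_def distrib_left)
    have "y \<notin> \<Lambda>"
    proof
      assume "y \<in> \<Lambda>"
      then obtain c where "y = ofA emb c * w" by (auto simp: lattice_of_def)
      hence "\<gamma> * z = ofA emb (g * c - b) * w"
        using \<gamma>y by (simp add: \<gamma>_def ofA_diff ofA_mult left_diff_distrib mult.assoc eq_diff_eq)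
      thus False using z by (auto simp: lattice_of_def \<gamma>_def)
    qed
    from goss_lattice_has_sum[OF this]
    have "((\<lambda>c. inverse (\<gamma> ^ n) * inverse ((y + ofA emb c * w) ^ n)) has_sum
        (inverse (\<gamma> ^ n) * poly G (inverse (e y)))) UNIV"
      by (rule na_has_sum_cmult)
    moreover have "inverse (\<gamma> ^ n) * inverse ((y + ofA emb c * w) ^ n) = f (b + g * c)" for c
    proof -
      have eq: "\<gamma> * (y + ofA emb c * w) = \<gamma> * z + ofA emb (b + g * c) * w"
        unfolding distrib_left \<gamma>y by (simp add: \<gamma>_def ofA_add ofA_mult algebra_simps)
      show ?thesis by (simp only: f_def eq[symmetric] power_mult_distrib inverse_mult_distrib)
    qed
    moreover have "e y = e z + torsion g b" by (simp add: y_def e_add torsion_def \<gamma>_def)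
    moreover have "inj (\<lambda>c. b + g * c)" using g by (auto simp: inj_on_def)
    ultimately show ?thesis unfolding has_sum_reindex[OF \<open>inj _\<close>] by (simp only: o_def s_def)
  qed
  have "disjoint_family_on (\<lambda>b. range (\<lambda>c. b + g * c)) B"
  proof (unfold disjoint_family_on_def, intro ballI impI)
    fix b b' assume b: "b \<in> B" "b' \<in> B" "b \<noteq> b'"
    have "b + g * c \<noteq> b' + g * c'" for c c'
    proof
      assume "b + g * c = b' + g * c'"
      hence "b - b' = g * (c' - c)" by (simp add: algebra_simps)
      hence "g dvd b - b'" by simp
      moreover have "b - b' \<in> polys_below (degree g)" using b by (simp add: B_def polys_below_def)
      ultimately have "b - b' = 0" by (metis dvd_imp_degree_le not_le polys_below_iff)
      thus False using b by simp
    qed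
    thus "range (\<lambda>c. b + g * c) \<inter> range (\<lambda>c. b' + g * c) = {}" by auto
  qed
  with finB part have "(f has_sum (\<Sum>b\<in>B. inverse (\<gamma> ^ n) * s b)) (\<Union>b\<in>B. range (\<lambda>c. b + g * c))"
    by (intro na_has_sum_UN_disjoint)
  moreover have "(\<Union>b\<in>B. range (\<lambda>c. b + g * c)) = UNIV"
  proof -
    have "a \<in> (\<Union>b\<in>B. range (\<lambda>c. b + g * c))" for a
    proof (rule UN_I)
      show "a mod g \<in> B" using degree_mod_less[OF g, of a] by (auto simp: B_def polys_below_iff)
      show "a \<in> range (\<lambda>c. a mod g + g * c)" by (rule range_eqI[of _ _ "a div g"]) simp
    qed
    thus ?thesis by blast
  qed
  ultimately have "(f has_sum (inverse (\<gamma> ^ n) * (\<Sum>b\<in>B. s b))) UNIV"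
    by (simp add: sum_distrib_left)
  moreover have "(f has_sum poly G (inverse (e (\<gamma> * z)))) UNIV"
    unfolding f_def using goss_lattice_has_sum z by (simp add: \<gamma>_def)
  ultimately have "inverse (\<gamma> ^ n) * (\<Sum>b\<in>B. s b) = poly G (inverse (e (\<gamma> * z)))"
    by (rule na_has_sum_unique)
  hence "(\<Sum>b\<in>B. s b) = \<gamma> ^ n * poly G (inverse (e (\<gamma> * z)))"
    using \<gamma> by (simp add: field_simps)
  moreover have "(\<Sum>b\<in>B. s b) = (\<Sum>\<mu>\<in>division_points emb g. poly G (inverse (e z + \<mu>)))"
    unfolding s_def B_def by (rule sum.reindex_bij_betw[OF torsion_props(1)[OF g]])
  ultimately show ?thesis by (simp add: \<gamma>_def)
qed

abbreviation goss_fps :: "'c fps \<Rightarrow> 'c fps" where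
  "goss_fps F \<equiv> poly (map_poly fps_const G) F"

text \<open>The distribution relation as an identity of series. It is the case a = 1 of the trace of
  G_n(u_a), to which the case of a prime to g is reduced by composition.\<close>

lemma goss_fps_shift_sum:
  assumes g: "g \<noteq> 0"
  shows "(\<Sum>\<mu>\<in>division_points emb g. goss_fps (shift_u \<mu>))
       = fps_const (ofA emb g ^ n) * goss_fps (carlitz_u g)"
proof (rule represents_unique[OF accum_0_u_values])
  show "represents u_values (\<Sum>\<mu>\<in>division_points emb g. goss_fps (shift_u \<mu>))
      (\<lambda>x. \<Sum>\<mu>\<in>division_points emb g. poly G (inverse (inverse x + \<mu>)))"
    by (intro represents_sum represents_poly represents_shift_u accum_0_u_values)
  show "represents u_values (fps_const (ofA emb g ^ n) * goss_fps (carlitz_u g))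
      (\<lambda>x. ofA emb g ^ n * poly G (inverse (poly (carlitz_poly emb g) (inverse x))))"
    by (intro represents_mult represents_const represents_poly represents_carlitz_u accum_0_u_values g)
  obtain r where r: "r > 0"
    "\<And>x. x \<in> u_values \<Longrightarrow> 0 < nm x \<Longrightarrow> nm x < r \<Longrightarrow> poly (carlitz_poly emb g) (inverse x) \<noteq> 0"
    using poly_inverse_nonzero_near_0[OF accum_0_u_values carlitz_poly_nonzero[OF g], of u_values] by blast
  have "(\<Sum>\<mu>\<in>division_points emb g. poly G (inverse (inverse x + \<mu>)))
      = ofA emb g ^ n * poly G (inverse (poly (carlitz_poly emb g) (inverse x)))"
    if x: "x \<in> u_values" "0 < nm x" "nm x < r" for x
  proof -
    obtain z where z: "inverse x = e z" using x(1) by (auto simp: u_values_def)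
    have "e (ofA emb g * z) \<noteq> 0" using r(2)[OF x] by (simp add: e_ofA_mult z)
    hence "ofA emb g * z \<notin> \<Lambda>" using e_eq_0_iff by blast
    from goss_distribution[OF g this] show ?thesis by (simp add: z e_ofA_mult)
  qed
  thus "\<exists>r>0. \<forall>x\<in>u_values. 0 < nm x \<and> nm x < r \<longrightarrow>
      (\<Sum>\<mu>\<in>division_points emb g. poly G (inverse (inverse x + \<mu>)))
      = ofA emb g ^ n * poly G (inverse (poly (carlitz_poly emb g) (inverse x)))"
    using r(1) by blast
qed

text \<open>The lowest possible power of u in u_a is q^deg a, and G has no constant term. This makes
  the sums over a converge.\<close>

lemma goss_fps_carlitz_u_nth_eq_0:
  assumes "a \<noteq> 0" "k < CARD('k) ^ degree a"
  shows "goss_fps (carlitz_u a) $ k = 0"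
proof -
  obtain R where "G = pCons 0 R" using goss_lattice_correct(1) by (metis coeff_pCons_0 pCons_cases)
  hence "goss_fps (carlitz_u a) = carlitz_u a * poly (map_poly fps_const R) (carlitz_u a)"
    by (simp add: map_poly_pCons)
  moreover have "carlitz_u a $ i = 0" if "i \<le> k" for i
    unfolding carlitz_u_def using assms that by (intro recip_fps_nth_eq_0) (simp add: degree_carlitz_poly)
  ultimately show ?thesis by (simp add: fps_mult_nth)
qed

text \<open>The cancellation law \<open>cop\<close> makes C_a injective on the torsion, and
  finiteness turns this into a permutation.\<close>

lemma goss_fps_shift_sum_coprime:
  assumes g: "g \<noteq> 0" and a: "a \<noteq> 0" and cop: "\<And>b. g dvd a * b \<Longrightarrow> g dvd b"
  shows "(\<Sum>\<mu>\<in>division_points emb g. goss_fps (carlitz_u a) oo shift_u \<mu>)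
       = (fps_const (ofA emb g ^ n) * goss_fps (carlitz_u a)) oo carlitz_u g"
proof -
  define D where "D = division_points emb g"
  note ua0 = carlitz_u_nth_0[OF a]
  note ug0 = carlitz_u_nth_0[OF g]
  have "inj_on (poly (carlitz_poly emb a)) D"
  proof (rule inj_onI)
    fix \<mu> \<nu> assume "\<mu> \<in> D" "\<nu> \<in> D" and eq: "poly (carlitz_poly emb a) \<mu> = poly (carlitz_poly emb a) \<nu>"
    then obtain b c where bc: "\<mu> = torsion g b" "\<nu> = torsion g c"
      unfolding D_def torsion_props(2)[OF g] by blast
    hence "torsion g (a * (b - c)) = 0" using eq by (simp add: carlitz_torsion torsion_diff right_diff_distrib)
    hence "g dvd b - c" using torsion_eq_0_iff[OF g] cop by blast
    hence "torsion g (b - c) = 0" using torsion_eq_0_iff[OF g] by blast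
    thus "\<mu> = \<nu>" by (simp add: bc torsion_diff)
  qed
  moreover have "poly (carlitz_poly emb a) ` D \<subseteq> D"
    unfolding D_def torsion_props(2)[OF g] by (auto simp: carlitz_torsion)
  ultimately have bij: "bij_betw (poly (carlitz_poly emb a)) D D"
    using torsion_props(3)[OF g] by (simp add: D_def bij_betw_def endo_inj_surj)
  have "(\<Sum>\<mu>\<in>D. goss_fps (carlitz_u a) oo shift_u \<mu>)
      = (\<Sum>\<mu>\<in>D. goss_fps (shift_u (poly (carlitz_poly emb a) \<mu>)) oo carlitz_u a)"
  proof (rule sum.cong)
    fix \<mu> assume "\<mu> \<in> D"
    hence "\<mu> \<in> range e" using division_points_subset[OF g] by (auto simp: D_def)
    from carlitz_u_shift[OF a this]
    show "goss_fps (carlitz_u a) oo shift_u \<mu> = goss_fps (shift_u (poly (carlitz_poly emb a) \<mu>)) oo carlitz_u a"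
      by (simp add: poly_fps_const_compose shift_u_nth_0 ua0)
  qed simp
  also have "\<dots> = (\<Sum>\<mu>\<in>D. goss_fps (shift_u \<mu>) oo carlitz_u a)"
    by (rule sum.reindex_bij_betw[OF bij])
  also have "\<dots> = (\<Sum>\<mu>\<in>D. goss_fps (shift_u \<mu>)) oo carlitz_u a"
    by (simp add: fps_compose_sum_distrib)
  also have "\<dots> = (fps_const (ofA emb g ^ n) * goss_fps (carlitz_u g)) oo carlitz_u a"
    unfolding D_def goss_fps_shift_sum[OF g] ..
  \<comment> \<open>u_a and u_g commute under composition, both orders giving the series of the
    product a g.\<close>
  also have "\<dots> = (fps_const (ofA emb g ^ n) * goss_fps (carlitz_u a)) oo carlitz_u g"
    by (simp add: fps_compose_mult_distrib poly_fps_const_compose ua0 ug0 carlitz_u_compose a g mult.commute)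
  finally show ?thesis by (simp add: D_def)
qed

text \<open>Translating by \<open>g\<close>-torsion does not change \<open>u\<^sub>a\<close>, and the number of terms is \<open>0\<close> in \<open>F\<^sub>q\<close>.\<close>

lemma goss_fps_shift_sum_dvd:
  assumes g: "g \<noteq> 0" "degree g > 0" and a: "a \<noteq> 0" "g dvd a"
  shows "(\<Sum>\<mu>\<in>division_points emb g. goss_fps (carlitz_u a) oo shift_u \<mu>) = 0"
proof -
  define D where "D = division_points emb g"
  have "goss_fps (carlitz_u a) oo shift_u \<mu> = goss_fps (carlitz_u a)" if \<mu>: "\<mu> \<in> D" for \<mu>
  proof -
    obtain b where "\<mu> = torsion g b" using \<mu> unfolding D_def torsion_props(2)[OF g(1)] by blast
    hence "poly (carlitz_poly emb a) \<mu> = 0"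
      using a torsion_eq_0_iff[OF g(1), of "a * b"] by (simp add: carlitz_torsion)
    moreover have "\<mu> \<in> range e" using \<mu> division_points_subset[OF g(1)] by (auto simp: D_def)
    ultimately have "carlitz_u a oo shift_u \<mu> = carlitz_u a"
      using carlitz_u_shift[OF a(1), of \<mu>] by (simp add: shift_u_0 fps_X_fps_compose_startby0 carlitz_u_nth_0 a)
    thus ?thesis by (simp add: poly_fps_const_compose shift_u_nth_0)
  qed
  hence "(\<Sum>\<mu>\<in>D. goss_fps (carlitz_u a) oo shift_u \<mu>) = of_nat (card D) * goss_fps (carlitz_u a)"
    by simp
  also have "of_nat (card D) = fps_const (of_nat CARD('k) ^ degree g :: 'c)"
    using torsion_props(4)[OF g(1)] by (simp add: D_def fps_of_nat flip: fps_const_power)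
  also have "\<dots> = 0" using of_nat_CARD_c g(2) by simp
  finally show ?thesis by (simp add: D_def)
qed

text \<open>Covers both index sets at once: what matters is that a set of monic polynomials is
  stable under multiplication by g and under cancellation of g.\<close>

lemma hecke_eigen:
  fixes S :: "'k poly set"
  assumes g: "lead_coeff g = 1" "irreducible g" and k: "n \<le> k"
    and S: "\<And>a. a \<in> S \<Longrightarrow> lead_coeff a = 1" "\<And>a. lead_coeff a = 1 \<Longrightarrow> g * a \<in> S \<longleftrightarrow> a \<in> S"
  defines "f \<equiv> (\<Sum>\<^sub>\<infinity>a\<in>S. fps_const (ofA emb a ^ (k - n)) * goss_u emb w n a)"
  shows "hecke emb w k g f = fps_const (ofA emb g ^ n) * f"
proof -
  define h where "h a = fps_const (ofA emb a ^ (k - n)) * goss_fps (carlitz_u a)" for a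
  define M where "M = {a. g dvd a}"
  have g0: "g \<noteq> 0" using g by auto
  have dg: "degree g > 0" using g by (auto simp: irreducible_def is_unit_iff_degree)
  have a0: "a \<noteq> 0" if "a \<in> S" for a using S(1)[OF that] by auto
  have prime: "prime_elem g" using g by (intro field_poly_irreducible_imp_prime)
  note ug0 = carlitz_u_nth_0[OF g0]
  \<comment> \<open>Nothing below u^(q^deg a) occurs in G_n(u_a), and q^d > d, so coefficient i only
    sees a of degree at most i.\<close>
  have fin: "finite {a \<in> S. h a $ i \<noteq> 0}" for i
  proof (rule finite_subset)
    show "{a \<in> S. h a $ i \<noteq> 0} \<subseteq> polys_below (Suc i)"
    proof
      fix a assume a: "a \<in> {a \<in> S. h a $ i \<noteq> 0}"
      hence "\<not> i < CARD('k) ^ degree a"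
        using goss_fps_carlitz_u_nth_eq_0[OF a0] by (auto simp: h_def)
      moreover have "degree a < CARD('k) ^ degree a"
        using CARD_ge_2[where 'k = 'k] by (intro power_gt_expt) simp
      ultimately show "a \<in> polys_below (Suc i)" by (simp add: polys_below_iff)
    qed
  qed (use card_polys_below in blast)
  have "finite {a \<in> S \<inter> M. h a $ i \<noteq> 0}" for i by (rule finite_subset[OF _ fin[of i]]) auto
  then obtain f1 where f1: "(h has_sum f1) (S \<inter> M)" by (rule fps_has_sum_exists)
  have "finite {a \<in> S - M. h a $ i \<noteq> 0}" for i by (rule finite_subset[OF _ fin[of i]]) auto
  then obtain f0 where f0: "(h has_sum f0) (S - M)" by (rule fps_has_sum_exists)
  have f01: "(h has_sum (f0 + f1)) S"
  proof -
    have "((\<lambda>a. if a \<in> M then 0 else h a) has_sum f0) S"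
      by (rule has_sum_cong_neutral[THEN iffD1, OF _ _ _ f0]) auto
    moreover have "((\<lambda>a. if a \<in> M then h a else 0) has_sum f1) S"
      by (rule has_sum_cong_neutral[THEN iffD1, OF _ _ _ f1]) auto
    ultimately have "((\<lambda>a. (if a \<in> M then 0 else h a) + (if a \<in> M then h a else 0)) has_sum (f0 + f1)) S"
      by (rule fps_has_sum_add)
    thus ?thesis by (rule has_sum_cong[THEN iffD1, rotated]) auto
  qed
  have hu: "fps_const (ofA emb a ^ (k - n)) * goss_u emb w n a = h a" if "a \<in> S" for a
    by (simp add: h_def goss_u_def u_at_eq a0 that)
  have "f = infsum h S" unfolding f_def using hu by (rule infsum_cong)
  hence f: "f = f0 + f1" using infsumI[OF f01] by simp
  have f_sum: "(h has_sum f) S" using f01 f by simp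
  \<comment> \<open>Required for the trace formula, since the sum in \<open>hecke_hat\<close> starts
    at j = 1.\<close>
  have fnth0: "f $ 0 = 0"
  proof -
    have "h a $ 0 = 0" if "a \<in> S" for a
      using goss_fps_carlitz_u_nth_eq_0[OF a0[OF that], of 0] by (simp add: h_def)
    hence "\<forall>\<^sub>F T in finite_subsets_at_top S. (\<Sum>a\<in>T. h a $ 0) = 0"
      unfolding eventually_finite_subsets_at_top by (intro exI[of _ "{}"]) (auto intro: sum.neutral)
    moreover have "\<forall>\<^sub>F T in finite_subsets_at_top S. (\<Sum>a\<in>T. h a $ 0) = f $ 0"
      using f_sum by (simp add: has_sum_fps_iff)
    ultimately have "\<forall>\<^sub>F T in finite_subsets_at_top S. f $ 0 = 0" by eventually_elim simp
    thus ?thesis by simp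
  qed
  \<comment> \<open>Substituting u_g turns u_a into u_(ga), and g^k a^(k-n) = g^n (g a)^(k-n). So
    this is g^n times the sum over the multiples of g in S.\<close>
  have V: "fps_const (ofA emb g ^ k) * (f oo carlitz_u g) = fps_const (ofA emb g ^ n) * f1"
  proof (rule fps_has_sum_unique)
    show "((\<lambda>a. fps_const (ofA emb g ^ k) * (h a oo carlitz_u g)) has_sum
        fps_const (ofA emb g ^ k) * (f oo carlitz_u g)) S"
      by (intro fps_has_sum_const_mult fps_has_sum_compose f_sum)
    have im: "(*) g ` S = S \<inter> M"
    proof safe
      fix b assume "b \<in> S" thus "g * b \<in> S" using S by blast
    next
      fix b assume b: "b \<in> S" "b \<in> M"
      then obtain c where c: "b = g * c" by (auto simp: M_def)
      hence "lead_coeff c = 1" using S(1)[OF b(1)] g by (simp add: lead_coeff_mult)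
      thus "b \<in> (*) g ` S" using S(2)[of c] b c by blast
    qed (auto simp: M_def)
    have inj: "inj_on ((*) g) S" using g0 by (auto simp: inj_on_def)
    have "(((\<lambda>a. fps_const (ofA emb g ^ n) * h a) \<circ> (*) g) has_sum fps_const (ofA emb g ^ n) * f1) S"
      unfolding has_sum_reindex[OF inj, symmetric] im by (rule fps_has_sum_const_mult[OF f1])
    thus "((\<lambda>a. fps_const (ofA emb g ^ k) * (h a oo carlitz_u g)) has_sum
        fps_const (ofA emb g ^ n) * f1) S"
    proof (rule has_sum_cong[THEN iffD1, rotated])
      fix a assume "a \<in> S"
      note a0 = a0[OF this]
      have "h a oo carlitz_u g = fps_const (ofA emb a ^ (k - n)) * goss_fps (carlitz_u (a * g))"
        using a0 g0 ug0
        by (simp add: h_def fps_compose_mult_distrib poly_fps_const_compose carlitz_u_compose)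
      moreover have "ofA emb g ^ k = ofA emb g ^ n * ofA emb g ^ (k - n)"
        using k by (simp flip: power_add)
      moreover have "ofA emb g ^ n * ofA emb (g * a) ^ (k - n)
          = ofA emb g ^ n * ofA emb g ^ (k - n) * ofA emb a ^ (k - n)"
        by (simp only: ofA_mult power_mult_distrib mult.assoc)
      ultimately show "((\<lambda>a. fps_const (ofA emb g ^ n) * h a) \<circ> (*) g) a
          = fps_const (ofA emb g ^ k) * (h a oo carlitz_u g)"
        by (simp add: h_def mult.commute[of a g] flip: mult.assoc)
    qed
  qed
  have T: "hecke_hat emb g f = fps_const (ofA emb g ^ n) * f0"
  proof -
    define D where "D = division_points emb g"
    define t where "t a = (\<Sum>\<mu>\<in>D. h a oo shift_u \<mu>)" for a
    have t_eq: "t a = fps_const (ofA emb a ^ (k - n)) * (\<Sum>\<mu>\<in>D. goss_fps (carlitz_u a) oo shift_u \<mu>)" for a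
      unfolding t_def h_def sum_distrib_left
      by (simp only: fps_compose_mult_distrib[OF shift_u_nth_0] fps_const_compose)
    have "(t has_sum (\<Sum>\<mu>\<in>D. f oo shift_u \<mu>)) S"
      unfolding t_def by (intro fps_has_sum_sum fps_has_sum_compose f_sum)
    moreover have "(t has_sum ((fps_const (ofA emb g ^ n) * f0) oo carlitz_u g)) S"
    proof (rule has_sum_cong_neutral[THEN iffD1, rotated -1])
      show "((\<lambda>a. (fps_const (ofA emb g ^ n) * h a) oo carlitz_u g) has_sum
          (fps_const (ofA emb g ^ n) * f0) oo carlitz_u g) (S - M)"
        by (intro fps_has_sum_const_mult fps_has_sum_compose f0)
      fix a assume "a \<in> S - (S - M)"
      thus "t a = 0" using goss_fps_shift_sum_dvd[OF g0 dg a0] by (simp add: t_eq D_def M_def)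
    next
      fix a assume a: "a \<in> (S - M) \<inter> S"
      have "g dvd b" if "g dvd a * b" for b
        using prime_elem_dvd_multD[OF prime that] a by (simp add: M_def)
      with g0 a0 a have "(\<Sum>\<mu>\<in>D. goss_fps (carlitz_u a) oo shift_u \<mu>)
          = (fps_const (ofA emb g ^ n) * goss_fps (carlitz_u a)) oo carlitz_u g"
        unfolding D_def by (intro goss_fps_shift_sum_coprime) blast+
      thus "(fps_const (ofA emb g ^ n) * h a) oo carlitz_u g = t a"
        unfolding t_eq h_def
        by (simp only: fps_compose_mult_distrib[OF ug0] fps_const_compose mult.left_commute)
    qed auto
    ultimately have "hecke_hat emb g f oo carlitz_u g = (fps_const (ofA emb g ^ n) * f0) oo carlitz_u g"
      unfolding hecke_hat_compose[OF g0 fnth0] D_def[symmetric] by (rule fps_has_sum_unique)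
    \<comment> \<open>Now undo the substitution: a nonzero series without constant term can be
      cancelled on the right of a composition.\<close>
    hence "(hecke_hat emb g f - fps_const (ofA emb g ^ n) * f0) oo carlitz_u g = 0"
      by (simp only: fps_compose_sub_distrib diff_self)
    moreover have "carlitz_u g \<noteq> 0"
      unfolding carlitz_u_def by (intro recip_fps_nonzero carlitz_poly_nonzero g0)
    ultimately show ?thesis using fps_compose_eq_0_iff[OF ug0] ug0 by (metis eq_iff_diff_eq_0)
  qed
  have "(\<Sum>\<^sub>\<infinity>j. fps_const (f $ j) * u_at emb w g ^ j) = f oo carlitz_u g"
    using infsumI[OF fps_compose_has_sum[OF ug0, of f]] by (simp add: u_at_eq g0)
  thus ?thesis
    unfolding hecke_def T using V by (simp add: f algebra_simps)
qed

end

end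

section \<open>Divisibility by the prime v\<close>

lemma irreducible_dvd_mult_iff:
  fixes v g a :: "'k::field poly"
  assumes "irreducible v" "\<not> v dvd g"
  shows "v dvd g * a \<longleftrightarrow> v dvd a"
  using assms field_poly_irreducible_imp_prime[of v] prime_elem_dvd_mult_iff by blast

lemma irreducible_coprime_iff:
  fixes v a :: "'k::field poly"
  assumes "irreducible v"
  shows "coprime a v \<longleftrightarrow> \<not> v dvd a"
proof
  show "\<not> v dvd a" if "coprime a v"
    using that assms by (meson coprime_common_divisor dvd_refl irreducible_not_unit)
  show "coprime a v" if "\<not> v dvd a"
  proof (rule coprimeI)
    fix d assume d: "d dvd a" "d dvd v"
    show "is_unit d"
    proof (rule ccontr)
      assume "\<not> is_unit d"
      hence "v dvd d" using d(2) assms by (meson irreducibleD')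
      thus False using d(1) that dvd_trans by blast
    qed
  qed
qed

theorem theorem4p4:
  fixes emb :: "'k::{field,finite} fls \<Rightarrow> 'c::{alg_closed_field,complete_space}"
    and w :: 'c
    and v g :: "'k poly"
    and k\<^sub>0 n :: nat
    and f\<^sub>0 f\<^sub>1 :: "'c fps"
  assumes "C_infinity emb"
    and "carlitz_period emb w"
    and "lead_coeff v = 1" and "irreducible v"
    and "k\<^sub>0 > 0" and "n > 0"
    and "\<exists>m>0. int k\<^sub>0 - 2 * int n = int m * (int CARD('k) - 1)"
    and "n \<le> CHAR('k) ^ multiplicity CHAR('k) (k\<^sub>0 - n)"
    and "f\<^sub>0 = (\<Sum>\<^sub>\<infinity>a\<in>{a. lead_coeff a = 1 \<and> coprime a v}.
                 fps_const (ofA emb a ^ (k\<^sub>0 - n)) * goss_u emb w n a)"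
    and "f\<^sub>1 = (\<Sum>\<^sub>\<infinity>a\<in>{a. lead_coeff a = 1 \<and> v dvd a}.
                 fps_const (ofA emb a ^ (k\<^sub>0 - n)) * goss_u emb w n a)"
    and "lead_coeff g = 1" and "irreducible g" and "\<not> v dvd g"
  shows "hecke emb w k\<^sub>0 g f\<^sub>0 = fps_const (ofA emb g ^ n) * f\<^sub>0
         \<and> hecke emb w k\<^sub>0 g f\<^sub>1 = fps_const (ofA emb g ^ n) * f\<^sub>1"
proof -
  interpret C_infinity emb by fact
  interpret carlitz_lattice emb w by unfold_locales fact
  obtain m where m: "int k\<^sub>0 - 2 * int n = int m * (int CARD('k) - 1)" using assms(7) by blast
  \<comment> \<open>From 2 n \<le> \<open>k\<^sub>0\<close> follows n \<le>
    \<open>k\<^sub>0\<close>, so the natural number subtraction \<open>k\<^sub>0 - n\<close> is a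
    true difference.\<close>
  have "int m * (int CARD('k) - 1) \<ge> 0" using CARD_ge_2[where 'k = 'k] by simp
  hence k: "n \<le> k\<^sub>0" using m by linarith
  note eigen = hecke_eigen[OF \<open>n > 0\<close> \<open>lead_coeff g = 1\<close> \<open>irreducible g\<close> k]
  \<comment> \<open>Primality of v and its not dividing g give the stability of both index sets
    under multiplication by g and cancellation of g.\<close>
  note dvd_iff = irreducible_dvd_mult_iff[OF \<open>irreducible v\<close> \<open>\<not> v dvd g\<close>]
  have lc: "lead_coeff (g * a) = lead_coeff a" for a
    using \<open>lead_coeff g = 1\<close> by (simp add: lead_coeff_mult)
  have "hecke emb w k\<^sub>0 g f\<^sub>0 = fps_const (ofA emb g ^ n) * f\<^sub>0"
    unfolding assms(9)
    by (rule eigen) (simp_all only: mem_Collect_eq lc dvd_iff irreducible_coprime_iff[OF \<open>irreducible v\<close>])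
  moreover have "hecke emb w k\<^sub>0 g f\<^sub>1 = fps_const (ofA emb g ^ n) * f\<^sub>1"
    unfolding assms(10) by (rule eigen) (simp_all only: mem_Collect_eq lc dvd_iff)
  ultimately show ?thesis ..
qed

end
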